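(* Let $1\le k\le m\le n$, let $\mathcal{M}\subset\mathbb{R}^n$ be an $m$-surface of class $C^p$ with $p\ge 2$, let $M=\mathbf{x}(R)\subset\mathcal{M}$ be a rectangular $k$-patch of class $C^2$, and let $f,g\colon M\to\mathcal{G}_n$ be of class $C^1$. Then $$\int_{M} g\, d\mathbf{x}_{(k)}\,\partial f=\int_{\beta(M)} g\, d\mathbf{x}_{(k-1)}\, f .$$ Here the left-hand side denotes $$\int_{R}\sum_{i=1}^{k}\Big[\frac{\partial g}{\partial s^i}\,\mathbf{x}_{(k)}\,\mathbf{x}^i f+g\,\mathbf{x}_{(k)}\,\mathbf{x}^i\,\frac{\partial f}{\partial s^i}\Big]\,ds^1\cdots ds^k ,$$ and the right-hand side denotes $$\sum_{i=1}^{k}\Big[\int_{R^i_+} g\,\mathbf{x}_{(k)}\,\mathbf{x}^i f\;ds^1\cdots\widehat{ds^i}\cdots ds^k-\int_{R^i_-} g\,\mathbf{x}_{(k)}\,\mathbf{x}^i f\;ds^1\cdots\widehat{ds^i}\cdots ds^k\Big],$$ with all products being geometric products in $\mathcal{G}_n$.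
   Context: Geometric algebra: $\mathcal{G}_n=\mathcal{G}_n(\mathbb{R}^n)$ is the real associative (Clifford) algebra of dimension $2^n$ generated by $\mathbb{R}^n$ with $\mathbf{a}^2=|\mathbf{a}|^2$ for every vector $\mathbf{a}\in\mathbb{R}^n$ (so the standard orthonormal basis vectors $\mathbf{e}_i$ anticommute and square to $1$). Juxtaposition is the geometric product; $\wedge$ is the outer product: for an $r$-vector $A_r$ and an $s$-vector $B_s$, $A_r\wedge B_s=\langle A_rB_s\rangle_{r+s}$ is the grade $r+s$ part of $A_rB_s$. For vectors, $\mathbf{a}\cdot\mathbf{b}$ is the Euclidean inner product. Patches: let $R=\prod_{i=1}^k[a^i,b^i]\subset\mathbb{R}^k$ be a $k$-rectangle with $a^i<b^i$, with coordinates $s=(s^1,\dots,s^k)$. A set $M\subset\mathcal{M}\subset\mathbb{R}^n$ is a rectangular $k$-patch of class $C^p$ ($p\ge 1$) if $M=\mathbf{x}(R)$, where $\mathbf{x}\colon R\to M$ is of class $C^p$, proper (it has a continuous inverse $\mathbf{x}^{-1}\colon M\to R$), and regular (the tangent vectors $\mathbf{x}_i=\partial\mathbf{x}/\partial s^i$, $i=1,\dots,k$, are linearly independent at every point). The tangent $k$-vector is $\mathbf{x}_{(k)}=\mathbf{x}_1\wedge\cdots\wedge\mathbf{x}_k$. The reciprocal vectors $\mathbf{x}^1,\dots,\mathbf{x}^k$ at a point of $M$ are the unique vectors in the span of $\mathbf{x}_1,\dots,\mathbf{x}_k$ with $\mathbf{x}^i\cdot\mathbf{x}_j=\delta^i_{\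 j}$. Functions on $M$ are understood to be defined (with the stated smoothness) on an open subset of $\mathcal{M}$ containing $M$, and are viewed as functions of $s\in R$ through $\mathbf{x}$; thus $\partial f/\partial s^i$ means $\partial (f\circ\mathbf{x})/\partial s^i$. Boundary: the faces of $R$ are $R^i_+=\{s\in R: s^i=b^i\}$ and $R^i_-=\{s\in R: s^i=a^i\}$; the boundary of $M$ is the chain $\beta(M)=\bigoplus_{i=1}^k(M^i_+\oplus M^i_-)$ with $M^i_\pm=\mathbf{x}(R^i_\pm)$. On $M^i_\pm$ the oriented tangent $(k-1)$-vector is $\mathbf{x}_{(k-1)}=\pm\mathbf{x}_{(k)}\mathbf{x}^i$ respectively, and $\int_{\beta(M)}g\,d\mathbf{x}_{(k-1)}f$ is the sum over all faces of $\int_{R^i_\pm} g\,\mathbf{x}_{(k-1)}f\,ds^1\cdots\widehat{ds^i}\cdots ds^k$ (hat meaning omission; for $k=1$ the integral over a face, which is a point, is evaluation at that point). Vector derivative: $\partial=\sum_{i=1}^k\mathbf{x}^i\,\partial/\partial s^i$ is two-sided: in $g\,d\mathbf{x}_{(k)}\,\partial f$ it differentiates both $g$ (to its left) and $f$ (to its right), but not $\mathbf{x}_{(k)}$ or $\mathbf{x}^i$. *)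

theory Defs
  imports "HOL-Analysis.Analysis"
begin

section \<open>The geometric algebra of Euclidean n-space\<close>

text \<open>
  A multivector is given by its coefficients with respect to the \<open>2^n\<close> blades
  \<open>e\<^sub>S = e\<^bsub>i1\<^esub> \<dots> e\<^bsub>ir\<^esub>\<close> with \<open>S = {i1 < \<dots> < ir}\<close>, where \<open>e\<^sub>i\<close> is the
  standard basis of \<open>real ^ 'n\<close>.  A separate type is needed because the multiplication
  of \<open>real ^ 'n set\<close> is componentwise.
\<close>

typedef (overloaded) ('n::finite) multivector = "UNIV :: (real ^ 'n set) set"
  morphisms coeffs Multivector by simp

setup_lifting type_definition_multivector

lemma multivector_eqI: "(\<And>S. coeffs A $ S = coeffs B $ S) \<Longrightarrow> A = B"
  by (metis coeffs_inject vec_eq_iff)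

instantiation multivector :: (finite) real_vector
begin

lift_definition zero_multivector :: "'a multivector" is 0 .
lift_definition plus_multivector :: "'a multivector \<Rightarrow> 'a multivector \<Rightarrow> 'a multivector" is "(+)" .
lift_definition minus_multivector :: "'a multivector \<Rightarrow> 'a multivector \<Rightarrow> 'a multivector" is "(-)" .
lift_definition uminus_multivector :: "'a multivector \<Rightarrow> 'a multivector" is "uminus" .
lift_definition scaleR_multivector :: "real \<Rightarrow> 'a multivector \<Rightarrow> 'a multivector" is "(*\<^sub>R)" .

instance
  by (standard; transfer) (simp_all add: algebra_simps)

end

instantiation multivector :: (finite) real_inner
begin

lift_definition inner_multivector :: "'a multivector \<Rightarrow> 'a multivector \<Rightarrow> real" is "(\<bullet>)" .
lift_definition norm_multivector :: "'a multivector \<Rightarrow> real" is norm .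
definition dist_multivector :: "'a multivector \<Rightarrow> 'a multivector \<Rightarrow> real"
  where "dist_multivector A B = norm (A - B)"
definition sgn_multivector :: "'a multivector \<Rightarrow> 'a multivector"
  where "sgn_multivector A = A /\<^sub>R norm A"
definition uniformity_multivector :: "('a multivector \<times> 'a multivector) filter"
  where "uniformity_multivector = (INF e\<in>{0 <..}. principal {(A, B). dist A B < e})"
definition open_multivector :: "'a multivector set \<Rightarrow> bool"
  where "open_multivector U \<longleftrightarrow>
    (\<forall>A\<in>U. eventually (\<lambda>(A', B). A' = A \<longrightarrow> B \<in> U) uniformity)"

instance
proof
  fix A B C :: "'a multivector" and r :: real and U :: "'a multivector set"
  show "dist A B = norm (A - B)" by (rule dist_multivector_def)
  show "sgn A = A /\<^sub>R norm A" by (rule sgn_multivector_def)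
  show "(uniformity :: ('a multivector \<times> 'a multivector) filter)
      = (INF e\<in>{0 <..}. principal {(A, B). dist A B < e})"
    by (rule uniformity_multivector_def)
  show "open U \<longleftrightarrow> (\<forall>A\<in>U. \<forall>\<^sub>F (A', B) in uniformity. A' = A \<longrightarrow> B \<in> U)"
    by (rule open_multivector_def)
  show "A \<bullet> B = B \<bullet> A" by transfer (rule inner_commute)
  show "(A + B) \<bullet> C = A \<bullet> C + B \<bullet> C" by transfer (rule inner_add_left)
  show "(r *\<^sub>R A) \<bullet> B = r * (A \<bullet> B)" by transfer (rule inner_scaleR_left)
  show "0 \<le> A \<bullet> A" by transfer (rule inner_ge_zero)
  show "A \<bullet> A = 0 \<longleftrightarrow> A = 0" by transfer (rule inner_eq_zero_iff)
  show "norm A = sqrt (A \<bullet> A)" by transfer (rule norm_eq_sqrt_inner)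
qed

end

instantiation multivector :: (finite) euclidean_space
begin

lift_definition Basis_multivector :: "'a multivector set" is Basis .

instance
proof
  show "(Basis :: 'a multivector set) \<noteq> {}"
    by transfer (rule nonempty_Basis)
  show "finite (Basis :: 'a multivector set)"
    by transfer (rule finite_Basis)
  fix A B :: "'a multivector"
  show "A \<in> Basis \<Longrightarrow> B \<in> Basis \<Longrightarrow> A \<bullet> B = (if A = B then 1 else 0)"
    by transfer (simp add: inner_Basis)
  show "(\<forall>B\<in>Basis. A \<bullet> B = 0) \<longleftrightarrow> A = 0"
    by transfer (rule euclidean_all_zero_iff)
qed

end

lemma DIM_multivector: "DIM('n::finite multivector) = 2 ^ CARD('n)"
proof -
  have "Basis = coeffs ` (Basis :: 'n multivector set)"
    by (simp add: Basis_multivector.rep_eq)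
  then have "DIM('n multivector) = DIM(real ^ 'n set)"
    by (metis card_image coeffs_inject inj_on_def)
  then show ?thesis
    by (simp add: card_UNIV_set card_Pow flip: Pow_UNIV)
qed

definition blade :: "'n::finite set \<Rightarrow> 'n multivector"
  where "blade S = Multivector (axis S 1)"

text \<open>
  Sorting the product \<open>e\<^sub>S e\<^sub>T\<close> costs one sign for every pair \<open>i \<in> S\<close>, \<open>j \<in> T\<close> with
  \<open>j < i\<close>; afterwards the factors with index in \<open>S \<inter> T\<close> cancel in pairs.
\<close>

definition reorder_sign :: "'n::{finite,linorder} set \<Rightarrow> 'n set \<Rightarrow> real"
  where "reorder_sign S T = (\<Prod>i\<in>S. \<Prod>j\<in>T. if j < i then -1 else 1)"

lemma prod_sym_diff_sign:
  fixes h :: "'a::finite \<Rightarrow> real"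
  assumes "\<And>i. h i * h i = 1"
  shows "prod h (sym_diff S T) = prod h S * prod h T"
proof -
  have 1: "prod h S = prod h (S - T) * prod h (S \<inter> T)"
    by (metis finite mult.commute prod.Int_Diff)
  have 2: "prod h T = prod h (T - S) * prod h (S \<inter> T)"
    by (metis Int_commute finite mult.commute prod.Int_Diff)
  have 3: "prod h (S \<inter> T) * prod h (S \<inter> T) = 1"
    by (simp add: assms flip: prod.distrib)
  have "prod h (sym_diff S T) = prod h (S - T) * prod h (T - S)"
    by (rule prod.union_disjoint) auto
  then show ?thesis
    using 1 2 3 by (simp add: mult.assoc mult.left_commute)
qed

lemma reorder_sign_sym_diff_left:
  "reorder_sign (sym_diff S T) U = reorder_sign S U * reorder_sign T U"
  unfolding reorder_sign_def
  by (rule prod_sym_diff_sign) (simp flip: prod.distrib add: if_distrib cong: if_cong)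

lemma reorder_sign_sym_diff_right:
  "reorder_sign U (sym_diff S T) = reorder_sign U S * reorder_sign U T"
  unfolding reorder_sign_def
  by (subst prod_sym_diff_sign) (simp_all add: prod.distrib)

lemma reorder_sign_empty [simp]: "reorder_sign {} S = 1" "reorder_sign S {} = 1"
  by (simp_all add: reorder_sign_def)

instantiation multivector :: ("{finite,linorder}") real_algebra_1
begin

definition one_multivector :: "'a multivector"
  where "one_multivector = blade {}"

text \<open>The bilinear extension of \<open>e\<^sub>S e\<^sub>T = reorder_sign S T e\<^bsub>S \<triangle> T\<^esub>\<close>.\<close>

definition times_multivector :: "'a multivector \<Rightarrow> 'a multivector \<Rightarrow> 'a multivector"
  where "A * B = (\<Sum>S\<in>UNIV. \<Sum>T\<in>UNIV.
    (coeffs A $ S * coeffs B $ T * reorder_sign S T) *\<^sub>R blade (sym_diff S T))"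

lemma coeffs_sum: "coeffs (sum F I) = (\<Sum>i\<in>I. coeffs (F i))"
  by (induction I rule: infinite_finite_induct)
    (simp_all add: zero_multivector.rep_eq plus_multivector.rep_eq)

lemma coeffs_blade: "coeffs (blade S) $ T = (if S = T then 1 else 0)"
  by (auto simp: blade_def Multivector_inverse axis_def)

lemma coeffs_times: "coeffs (A * B) $ U =
  (\<Sum>S\<in>UNIV. coeffs A $ S * coeffs B $ (sym_diff S U) * reorder_sign S (sym_diff S U))"
proof -
  have eq: "sym_diff S T = U \<longleftrightarrow> T = sym_diff S U" for S T :: "'a set"
    by auto
  show ?thesis
    by (simp add: times_multivector_def coeffs_sum scaleR_multivector.rep_eq coeffs_blade eq
        if_distrib cong: if_cong)
qed

instance
proof
  fix A B C :: "'a multivector" and r :: real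
  show "(A + B) * C = A * C + B * C" "A * (B + C) = A * B + A * C"
    by (auto intro!: multivector_eqI
        simp: coeffs_times plus_multivector.rep_eq algebra_simps sum.distrib)
  show "r *\<^sub>R A * B = r *\<^sub>R (A * B)" "A * r *\<^sub>R B = r *\<^sub>R (A * B)"
    by (auto intro!: multivector_eqI
        simp: coeffs_times scaleR_multivector.rep_eq sum_distrib_left ac_simps)
  have "coeffs (1 * A) $ U = (\<Sum>S\<in>UNIV. if S = ({} :: 'a set) then coeffs A $ U else 0)" for U
    unfolding coeffs_times one_multivector_def coeffs_blade by (rule sum.cong) auto
  then show "1 * A = A"
    by (auto intro!: multivector_eqI)
  have "coeffs (A * 1) $ U = (\<Sum>S\<in>UNIV. if S = U then coeffs A $ U else 0)" for U
    unfolding coeffs_times one_multivector_def coeffs_blade by (rule sum.cong) auto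
  then show "A * 1 = A"
    by (auto intro!: multivector_eqI)
  have "coeffs (blade ({} :: 'a set)) $ {} \<noteq> coeffs (0 :: 'a multivector) $ {}"
    unfolding coeffs_blade by (simp add: zero_multivector.rep_eq)
  then show "(0 :: 'a multivector) \<noteq> 1"
    by (auto simp: one_multivector_def)
  show "A * B * C = A * (B * C)"
  proof (rule multivector_eqI)
    fix U
    have arith: "y1 * y2 * r1 * y3 * r2 = y1 * (y2 * y3 * r3) * r4" if "r1 * r2 = r3 * r4"
      for y1 y2 y3 r1 r2 r3 r4 :: real
      using that by algebra
    have inj: "bij_betw (sym_diff S) UNIV UNIV" for S :: "'a set"
      by (rule bij_betwI[where g = "sym_diff S"]) auto
    have "coeffs (A * B * C) $ U = (\<Sum>V\<in>UNIV. \<Sum>S\<in>UNIV. coeffs A $ S * coeffs B $ (sym_diff S V)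
        * reorder_sign S (sym_diff S V) * coeffs C $ (sym_diff V U) * reorder_sign V (sym_diff V U))"
      by (simp add: coeffs_times sum_distrib_right)
    also have "\<dots> = (\<Sum>S\<in>UNIV. \<Sum>V\<in>UNIV. coeffs A $ S * coeffs B $ (sym_diff S V)
        * reorder_sign S (sym_diff S V) * coeffs C $ (sym_diff V U) * reorder_sign V (sym_diff V U))"
      by (rule sum.swap)
    also have "\<dots> = (\<Sum>S\<in>UNIV. \<Sum>T\<in>UNIV. coeffs A $ S * (coeffs B $ T *
        coeffs C $ (sym_diff T (sym_diff S U)) * reorder_sign T (sym_diff T (sym_diff S U)))
        * reorder_sign S (sym_diff S U))"
    proof (rule sum.cong[OF refl])
      fix S :: "'a set"
      have a: "sym_diff V (sym_diff V T) = T" for V T :: "'a set" by auto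
      have b: "sym_diff (sym_diff S T) U = sym_diff T (sym_diff S U)" for T by auto
      have c: "reorder_sign S T * reorder_sign (sym_diff S T) (sym_diff T (sym_diff S U))
        = reorder_sign T (sym_diff T (sym_diff S U)) * reorder_sign S (sym_diff S U)" for T
      proof -
        have "reorder_sign S T * reorder_sign S (sym_diff T (sym_diff S U)) = reorder_sign S (sym_diff S U)"
          by (simp only: a flip: reorder_sign_sym_diff_right)
        then show ?thesis
          by (simp add: reorder_sign_sym_diff_left ac_simps)
      qed
      show "(\<Sum>V\<in>UNIV. coeffs A $ S * coeffs B $ (sym_diff S V)
        * reorder_sign S (sym_diff S V) * coeffs C $ (sym_diff V U) * reorder_sign V (sym_diff V U))
        = (\<Sum>T\<in>UNIV. coeffs A $ S * (coeffs B $ T *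
        coeffs C $ (sym_diff T (sym_diff S U)) * reorder_sign T (sym_diff T (sym_diff S U)))
        * reorder_sign S (sym_diff S U))"
        by (subst sum.reindex_bij_betw[OF inj[of S], symmetric], unfold a b)
          (rule sum.cong[OF refl], rule arith, rule c)
    qed
    also have "\<dots> = coeffs (A * (B * C)) $ U"
      by (simp add: coeffs_times sum_distrib_right sum_distrib_left)
    finally show "coeffs (A * B * C) $ U = coeffs (A * (B * C)) $ U" .
  qed
qed

end

lemma blade_mult: "blade S * blade T = reorder_sign S T *\<^sub>R blade (sym_diff S T)"
proof (rule multivector_eqI)
  fix U
  have "coeffs (blade S * blade T) $ U = (\<Sum>V\<in>UNIV. if V = S then
      (if T = sym_diff S U then reorder_sign S (sym_diff S U) else 0) else 0)"
    unfolding coeffs_times coeffs_blade by (rule sum.cong) auto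
  then have "coeffs (blade S * blade T) $ U
      = (if T = sym_diff S U then reorder_sign S (sym_diff S U) else 0)"
    by simp
  moreover have "T = sym_diff S U \<longleftrightarrow> sym_diff S T = U"
    by auto
  ultimately show "coeffs (blade S * blade T) $ U
      = coeffs (reorder_sign S T *\<^sub>R blade (sym_diff S T)) $ U"
    by (simp only: coeffs_blade scaleR_multivector.rep_eq vector_scaleR_component) auto
qed

definition mvec :: "real ^ 'n::finite \<Rightarrow> 'n multivector"
  where "mvec u = (\<Sum>i\<in>UNIV. (u $ i) *\<^sub>R blade {i})"

lemma blade_anticommute: "i \<noteq> j \<Longrightarrow> blade {i} * blade {j} = - (blade {j} * blade {i})"
  for i j :: "'n::{finite,linorder}"
  by (cases i j rule: linorder_cases)
    (auto simp: blade_mult reorder_sign_def insert_commute Un_commute)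

lemma blade_square: "blade {i} * blade {i} = 1"
  by (simp add: blade_mult reorder_sign_def one_multivector_def)

lemma mvec_square: "mvec u * mvec u = (norm u)\<^sup>2 *\<^sub>R 1"
  for u :: "real ^ 'n::{finite,linorder}"
proof -
  define F where "F i j = (u $ i * u $ j) *\<^sub>R (blade {i} * blade {j})" for i j
  have swap: "F i j = - F j i" if "i \<noteq> j" for i j
    using blade_anticommute[OF that] by (simp add: F_def mult.commute)
  have sq: "mvec u * mvec u = (\<Sum>i\<in>UNIV. \<Sum>j\<in>UNIV. F i j)"
    unfolding mvec_def F_def sum_product mult_scaleR_left mult_scaleR_right scaleR_scaleR by (simp only: mult.commute)
  have "2 *\<^sub>R (mvec u * mvec u) = (\<Sum>i\<in>UNIV. \<Sum>j\<in>UNIV. F i j) + (\<Sum>i\<in>UNIV. \<Sum>j\<in>UNIV. F j i)"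
    unfolding sq scaleR_2 by (rule arg_cong[OF sum.swap])
  also have "\<dots> = (\<Sum>i\<in>UNIV. \<Sum>j\<in>UNIV. if i = j then 2 *\<^sub>R F i i else 0)"
    unfolding sum.distrib[symmetric]
  proof (intro sum.cong refl)
    fix i j
    show "F i j + F j i = (if i = j then 2 *\<^sub>R F i i else 0)"
      using swap[of i j] by (cases "i = j") (simp_all only: scaleR_2 if_True if_False simp_thms ab_left_minus)
  qed
  also have "\<dots> = 2 *\<^sub>R ((norm u)\<^sup>2 *\<^sub>R 1)"
    by (simp add: F_def blade_square power2_norm_eq_inner inner_vec_def
        sum_distrib_left flip: scaleR_sum_left)
  finally show ?thesis
    by (simp only: scaleR_cancel_left) simp
qed

lemma blade_insert_min:
  assumes "\<And>j. j \<in> S \<Longrightarrow> i < j"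
  shows "blade (insert i S) = blade {i} * blade S"
proof -
  have "\<not> j < i" if "j \<in> S" for j
    using assms[OF that] by simp
  then have "reorder_sign {i} S = 1"
    by (simp add: reorder_sign_def)
  moreover have "i \<notin> S"
    using assms by blast
  then have "sym_diff {i} S = insert i S"
    by auto
  ultimately show ?thesis
    by (simp only: blade_mult scaleR_one)
qed

definition grade_part :: "nat \<Rightarrow> 'n::finite multivector \<Rightarrow> 'n multivector"
  where "grade_part r A = (\<Sum>S | card S = r. (coeffs A $ S) *\<^sub>R blade S)"

definition outer :: "'n::{finite,linorder} multivector \<Rightarrow> 'n multivector \<Rightarrow> 'n multivector"
    (infixl \<open>\<^bold>\<and>\<close> 70)
  where "A \<^bold>\<and> B = (\<Sum>r\<le>CARD('n). \<Sum>s\<le>CARD('n).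
    grade_part (r + s) (grade_part r A * grade_part s B))"


section \<open>Differentiability classes, surfaces and patches\<close>

text \<open>
  Differentiability class \<open>C^p\<close> on an open set, or on a closed box with nonempty interior
  (one-sided derivatives at the faces); on such sets the derivative is unique.
\<close>

primrec Ck_on :: "nat \<Rightarrow> ('a::euclidean_space \<Rightarrow> 'b::real_normed_vector) \<Rightarrow> 'a set \<Rightarrow> bool"
  where
    "Ck_on 0 f S \<longleftrightarrow> continuous_on S f"
  | "Ck_on (Suc p) f S \<longleftrightarrow>
      (\<exists>f'. (\<forall>x\<in>S. (f has_derivative f' x) (at x within S)) \<and> (\<forall>v. Ck_on p (\<lambda>x. f' x v) S))"

definition set_coord :: "real ^ 'k \<Rightarrow> 'k \<Rightarrow> real \<Rightarrow> real ^ 'k::finite"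
  where "set_coord s i t = (\<chi> j. if j = i then t else s $ j)"

text \<open>At the faces of a closed box \<open>R\<close> this is the one-sided partial derivative.\<close>

definition partial_deriv ::
    "(real ^ 'k) set \<Rightarrow> (real ^ 'k::finite \<Rightarrow> 'b::real_normed_vector) \<Rightarrow> 'k \<Rightarrow> real ^ 'k \<Rightarrow> 'b"
  where "partial_deriv R h i s =
    vector_derivative (\<lambda>t. h (set_coord s i t)) (at (s $ i) within {t. set_coord s i t \<in> R})"

definition proper_regular ::
    "nat \<Rightarrow> (real ^ 'k) set \<Rightarrow> (real ^ 'k::finite \<Rightarrow> real ^ 'n::finite) \<Rightarrow> (real ^ 'n) set \<Rightarrow> bool"
  where "proper_regular p R x M \<longleftrightarrow>
    Ck_on p x R \<and>
    (\<exists>y. homeomorphism R M x y) \<and>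
    (\<forall>s\<in>R. inj (\<lambda>i. partial_deriv R x i s) \<and> independent (range (\<lambda>i. partial_deriv R x i s)))"

definition rect_patch ::
    "nat \<Rightarrow> real ^ 'k \<Rightarrow> real ^ 'k \<Rightarrow> (real ^ 'k::finite \<Rightarrow> real ^ 'n::finite) \<Rightarrow> (real ^ 'n) set \<Rightarrow> bool"
  where "rect_patch p a b x M \<longleftrightarrow> (\<forall>i. a $ i < b $ i) \<and> proper_regular p (cbox a b) x M"

text \<open>
  An m-surface with \<open>m = CARD('m)\<close>: every point has a relatively open neighbourhood that is
  the image of an open subset of \<open>real ^ 'm\<close> under a proper regular map.
\<close>

definition surface :: "'m::finite itself \<Rightarrow> nat \<Rightarrow> (real ^ 'n::finite) set \<Rightarrow> bool"
  where "surface _ p N \<longleftrightarrow>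
    (\<forall>q\<in>N. \<exists>U V (\<phi> :: real ^ 'm \<Rightarrow> real ^ 'n).
      open U \<and> openin (top_of_set N) V \<and> q \<in> V \<and> proper_regular p U \<phi> V)"

text \<open>
  \<open>C^p\<close> on a subset \<open>W\<close> of a surface: locally the restriction of a \<open>C^p\<close> function on an open
  subset of the ambient space.
\<close>

definition Ck_on_subset ::
    "nat \<Rightarrow> ('a::euclidean_space \<Rightarrow> 'b::real_normed_vector) \<Rightarrow> 'a set \<Rightarrow> bool"
  where "Ck_on_subset p f W \<longleftrightarrow>
    (\<forall>q\<in>W. \<exists>U F. open U \<and> q \<in> U \<and> Ck_on p F U \<and> (\<forall>y\<in>U \<inter> W. F y = f y))"

definition Ck_near ::
    "nat \<Rightarrow> ('a::euclidean_space) set \<Rightarrow> 'a set \<Rightarrow> ('a \<Rightarrow> 'b::real_normed_vector) \<Rightarrow> bool"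
  where "Ck_near p N M f \<longleftrightarrow>
    (\<exists>W. openin (top_of_set N) W \<and> M \<subseteq> W \<and> Ck_on_subset p f W)"


section \<open>Directed integrals\<close>

text \<open>The order on \<open>'k\<close> is the order of the coordinates \<open>s^1, \<dots>, s^k\<close>.\<close>

definition tangent_kvector ::
    "(real ^ 'k::{finite,linorder}) set \<Rightarrow> (real ^ 'k::{finite,linorder} \<Rightarrow> real ^ 'n::{finite,linorder})
      \<Rightarrow> real ^ 'k::{finite,linorder} \<Rightarrow> 'n multivector"
  where "tangent_kvector R x s =
    foldl (\<^bold>\<and>) 1 (map (\<lambda>i. mvec (partial_deriv R x i s)) (sorted_list_of_set UNIV))"

definition reciprocal :: "('k::finite \<Rightarrow> real ^ 'n::finite) \<Rightarrow> 'k \<Rightarrow> real ^ 'n"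
  where "reciprocal v i =
    (THE w. w \<in> span (range v) \<and> (\<forall>j. w \<bullet> v j = (if i = j then 1 else 0)))"

lemma reciprocal_ex1:
  fixes v :: "'k::finite \<Rightarrow> real ^ 'n::finite"
  assumes "inj v" "independent (range v)"
  shows "\<exists>!w. w \<in> span (range v) \<and> (\<forall>j. w \<bullet> v j = (if i = j then 1 else 0))"
proof (rule ex_ex1I)
  obtain y z where y: "y \<in> span (v ` (UNIV - {i}))"
    and z: "\<And>w. w \<in> span (v ` (UNIV - {i})) \<Longrightarrow> orthogonal z w" and yz: "v i = y + z"
    using orthogonal_subspace_decomp_exists[of "v ` (UNIV - {i})" "v i"] by blast
  have "v i \<notin> span (range v - {v i})"
    using assms(2) unfolding dependent_def by blast
  moreover have "range v - {v i} = v ` (UNIV - {i})"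
    using assms(1) by (auto simp: inj_def)
  ultimately have "z \<noteq> 0"
    using y yz by auto
  have "span (v ` (UNIV - {i})) \<subseteq> span (range v)"
    by (rule span_mono) auto
  then have "y \<in> span (range v)"
    using y by blast
  then have "z \<in> span (range v)"
    using span_diff[OF span_base[OF rangeI[of v i]], of y] yz by (metis add_diff_cancel_left')
  moreover have "z \<bullet> v i = z \<bullet> z"
    using z[OF y] by (simp add: yz inner_add_right orthogonal_def)
  moreover have "z \<bullet> v j = 0" if "j \<noteq> i" for j
    using z[of "v j"] that by (auto simp: orthogonal_def intro: span_base)
  ultimately have "z /\<^sub>R (z \<bullet> z) \<in> span (range v) \<and>
      (\<forall>j. (z /\<^sub>R (z \<bullet> z)) \<bullet> v j = (if i = j then 1 else 0))"
    using \<open>z \<noteq> 0\<close> by (auto intro: span_scale)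
  then show "\<exists>w. w \<in> span (range v) \<and> (\<forall>j. w \<bullet> v j = (if i = j then 1 else 0))"
    by blast
next
  fix w w'
  assume w: "w \<in> span (range v) \<and> (\<forall>j. w \<bullet> v j = (if i = j then 1 else 0))"
    and w': "w' \<in> span (range v) \<and> (\<forall>j. w' \<bullet> v j = (if i = j then 1 else 0))"
  have "w - w' \<in> span (range v)"
    using w w' by (auto intro: span_diff)
  moreover have "orthogonal (w - w') u" if u: "u \<in> range v" for u
  proof -
    obtain j where "u = v j"
      using u by blast
    then show ?thesis
      using w w' by (simp add: orthogonal_def inner_diff_left)
  qed
  ultimately have "orthogonal (w - w') (w - w')"
    by (rule orthogonal_to_span)
  then show "w = w'"
    by (simp add: orthogonal_self)
qed

definition reciprocal_tangent ::
    "(real ^ 'k) set \<Rightarrow> (real ^ 'k::finite \<Rightarrow> real ^ 'n::finite) \<Rightarrow> 'k \<Rightarrow> real ^ 'k \<Rightarrow> real ^ 'n"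
  where "reciprocal_tangent R x i s = reciprocal (\<lambda>j. partial_deriv R x j s) i"

text \<open>
  The integral of \<open>g dx_(k) \<partial> f\<close>, where \<open>\<partial> = \<Sum>\<^sub>i x^i \<partial>/\<partial>s^i\<close> acts on \<open>g\<close> and \<open>f\<close> but not on
  \<open>x_(k)\<close> or \<open>x^i\<close>.
\<close>

definition patch_integral ::
    "real ^ 'k::{finite,linorder} \<Rightarrow> real ^ 'k::{finite,linorder}
      \<Rightarrow> (real ^ 'k::{finite,linorder} \<Rightarrow> real ^ 'n::{finite,linorder})
      \<Rightarrow> (real ^ 'n::{finite,linorder} \<Rightarrow> 'n multivector)
      \<Rightarrow> (real ^ 'n::{finite,linorder} \<Rightarrow> 'n multivector) \<Rightarrow> 'n multivector"
  where "patch_integral a b x g f = (LINT s : cbox a b | lborel. \<Sum>i\<in>UNIV.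
      partial_deriv (cbox a b) (g \<circ> x) i s * tangent_kvector (cbox a b) x s
        * mvec (reciprocal_tangent (cbox a b) x i s) * f (x s)
    + g (x s) * tangent_kvector (cbox a b) x s
        * mvec (reciprocal_tangent (cbox a b) x i s) * partial_deriv (cbox a b) (f \<circ> x) i s)"

text \<open>
  The integral over the face \<open>s^i = c\<close> of the box, with respect to Lebesgue measure in the
  remaining coordinates; for \<open>k = 1\<close> the product measure over the empty index set is a point
  mass and the integral is an evaluation.
\<close>

definition face_integral ::
    "real ^ 'k \<Rightarrow> real ^ 'k \<Rightarrow> 'k \<Rightarrow> real \<Rightarrow> (real ^ 'k::finite \<Rightarrow> 'b) \<Rightarrow> 'b::{banach,second_countable_topology}"
  where "face_integral a b i c h =
    (LINT t : (\<Pi>\<^sub>E j\<in>UNIV - {i}. {a $ j..b $ j}) | (\<Pi>\<^sub>M j\<in>UNIV - {i}. lborel).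
      h (\<chi> j. if j = i then c else t j))"

text \<open>The oriented tangent (k-1)-vector on the faces; \<open>\<sigma> = 1\<close> for \<open>s^i = b^i\<close>, \<open>\<sigma> = -1\<close> for \<open>s^i = a^i\<close>.\<close>

definition boundary_tangent ::
    "(real ^ 'k::{finite,linorder}) set \<Rightarrow> (real ^ 'k::{finite,linorder} \<Rightarrow> real ^ 'n::{finite,linorder})
      \<Rightarrow> 'k \<Rightarrow> real \<Rightarrow> real ^ 'k::{finite,linorder} \<Rightarrow> 'n multivector"
  where "boundary_tangent R x i \<sigma> s =
    \<sigma> *\<^sub>R (tangent_kvector R x s * mvec (reciprocal_tangent R x i s))"

definition boundary_integral ::
    "real ^ 'k::{finite,linorder} \<Rightarrow> real ^ 'k::{finite,linorder}
      \<Rightarrow> (real ^ 'k::{finite,linorder} \<Rightarrow> real ^ 'n::{finite,linorder})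
      \<Rightarrow> (real ^ 'n::{finite,linorder} \<Rightarrow> 'n multivector)
      \<Rightarrow> (real ^ 'n::{finite,linorder} \<Rightarrow> 'n multivector) \<Rightarrow> 'n multivector"
  where "boundary_integral a b x g f = (\<Sum>i\<in>UNIV.
      face_integral a b i (b $ i) (\<lambda>s. g (x s) * boundary_tangent (cbox a b) x i 1 s * f (x s))
    + face_integral a b i (a $ i) (\<lambda>s. g (x s) * boundary_tangent (cbox a b) x i (-1) s * f (x s)))"

end

theory Submission
  imports Defs
begin

text \<open>
  Write \<open>v\<^sub>i\<close> for the tangent vectors, \<open>w\<^sub>i\<close> for the reciprocal vectors and \<open>T\<close> for the tangent
  k-vector.  The product rule gives
  \<open>\<Sum>\<^sub>i \<partial>\<^sub>i (g T w\<^sub>i f) = \<Sum>\<^sub>i [(\<partial>\<^sub>i g) T w\<^sub>i f + g T w\<^sub>i (\<partial>\<^sub>i f)] + g (\<Sum>\<^sub>i \<partial>\<^sub>i (T w\<^sub>i)) f\<close>,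
  and integrating \<open>\<partial>\<^sub>i\<close> over the box in the variable \<open>s\<^sup>i\<close> first turns it into a difference of face
  integrals (\<open>integral_partial_deriv_cbox\<close>).  So the theorem amounts to
  \<open>\<Sum>\<^sub>i \<partial>\<^sub>i (T w\<^sub>i) = 0\<close>, together with the differentiability of \<open>T w\<^sub>i\<close>.

  Both come from one formula: \<open>T w\<^sub>i\<close> is, up to sign, the outer product of the \<open>v\<^sub>j\<close> with \<open>j \<noteq> i\<close>, here
  called the cofactor of \<open>i\<close> (\<open>wedge_mult_reciprocal\<close>).  Indeed \<open>T w\<^sub>i\<close> splits into
  \<open>T \<and> w\<^sub>i\<close>, which vanishes because \<open>w\<^sub>i\<close> lies in the span of the \<open>v\<^sub>j\<close>, and the contraction of
  \<open>T\<close> by \<open>w\<^sub>i\<close>, which is an antiderivation and hence deletes the factor \<open>v\<^sub>i\<close>.  A cofactor is a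
  polynomial in the first derivatives of the parametrization, which is of class \<open>C\<^sup>2\<close>, so it is of class
  \<open>C\<^sup>1\<close>.  In \<open>\<Sum>\<^sub>i \<partial>\<^sub>i (T w\<^sub>i)\<close> the second derivatives \<open>\<partial>\<^sub>i v\<^sub>j\<close> and \<open>\<partial>\<^sub>j v\<^sub>i\<close>, which are equal,
  occur with opposite signs, and everything cancels (\<open>sum_cofactor_deriv_eq_0\<close>).

  The vanishing is proved by induction on the list of factors, without any bookkeeping of signs:
  besides the symmetry of second derivatives it uses only that outer multiplications by two vectors
  anticommute and that the derivative of the outer product of a list is \<open>\<Sum>\<^sub>j cofactor\<^sub>j \<and> v\<^sub>j'\<close>.
\<close>

section \<open>Outer product and contraction by a vector\<close>

lemma multivector_blade_expansion: "A = (\<Sum>S\<in>UNIV. (coeffs A $ S) *\<^sub>R blade S)"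
  for A :: "'n::{finite,linorder} multivector"
  by (rule multivector_eqI)
    (simp add: coeffs_sum scaleR_multivector.rep_eq coeffs_blade if_distrib cong: if_cong)

lemma linear_eq_on_blades:
  fixes F G :: "'n::{finite,linorder} multivector \<Rightarrow> 'b::real_vector"
  assumes "linear F" "linear G" "\<And>S. F (blade S) = G (blade S)"
  shows "F A = G A"
  by (subst (1 2) multivector_blade_expansion[of A])
    (simp only: linear_sum[OF assms(1)] linear_sum[OF assms(2)]
      linear_scale[OF assms(1)] linear_scale[OF assms(2)] assms(3))

lemma bilinear_times_multivector:
  "bilinear ((*) :: 'n::{finite,linorder} multivector \<Rightarrow> 'n multivector \<Rightarrow> 'n multivector)"
  by (simp add: bilinear_def linear_iff algebra_simps)

lemma linear_mvec: "linear (mvec :: real ^ 'n::{finite,linorder} \<Rightarrow> 'n multivector)"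
  by (simp add: linear_iff mvec_def scaleR_add_left sum.distrib scaleR_sum_right)

lemma linear_eq_on_axes:
  fixes F G :: "real ^ 'n::{finite,linorder} \<Rightarrow> 'b::real_vector"
  assumes "linear F" "linear G" "\<And>i. F (axis i 1) = G (axis i 1)"
  shows "F u = G u"
  using linear_eq_stdbasis[OF assms(1,2)] assms(3) by (force simp: Basis_vec_def)

lemma mvec_axis: "mvec (axis i 1) = blade {i}" for i :: "'n::{finite,linorder}"
  by (simp add: mvec_def axis_def if_distrib[of "\<lambda>c. c *\<^sub>R _"] cong: if_cong)

lemma mvec_polarization: "mvec u * mvec v + mvec v * mvec u = (2 * (u \<bullet> v)) *\<^sub>R 1"
  for u v :: "real ^ 'n::{finite,linorder}"
proof -
  have "mvec (u + v) * mvec (u + v) = (norm (u + v))\<^sup>2 *\<^sub>R 1"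
    by (rule mvec_square)
  then have "mvec u * mvec v + mvec v * mvec u + (norm u)\<^sup>2 *\<^sub>R 1 + (norm v)\<^sup>2 *\<^sub>R 1
    = ((norm u)\<^sup>2 + (norm v)\<^sup>2 + 2 * (u \<bullet> v)) *\<^sub>R 1"
    by (simp add: linear_add[OF linear_mvec] distrib_left distrib_right mvec_square
       power2_norm_eq_inner inner_add_left inner_add_right inner_commute[of v u] algebra_simps)
  then show ?thesis
    by (simp add: scaleR_add_left)
qed

text \<open>
  The grade involution, the automorphism of the algebra that negates vectors.  With it the outer
  product and the contraction by a vector become half-sums and half-differences of geometric products,
  so that their commutation rules reduce to associativity and \<open>uv + vu = 2 (u \<bullet> v)\<close>.
\<close>

definition grade_inv :: "'n::{finite,linorder} multivector \<Rightarrow> 'n multivector"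
  where "grade_inv A = (\<Sum>S\<in>UNIV. ((-1) ^ card S * coeffs A $ S) *\<^sub>R blade S)"

lemma linear_grade_inv: "linear grade_inv"
  by (simp add: linear_iff grade_inv_def plus_multivector.rep_eq scaleR_multivector.rep_eq
      algebra_simps sum.distrib scaleR_sum_right)

lemma grade_inv_blade: "grade_inv (blade S) = (-1) ^ card S *\<^sub>R blade S"
  by (simp add: grade_inv_def coeffs_blade if_distrib[of "\<lambda>c. _ * c"]
    if_distrib[of "\<lambda>c. c *\<^sub>R _"] cong: if_cong)

lemma grade_inv_grade_inv: "grade_inv (grade_inv A) = A"
  by (rule linear_eq_on_blades[where F = "\<lambda>A. grade_inv (grade_inv A)" and G = "\<lambda>A. A"])
    (use linear_compose[OF linear_grade_inv linear_grade_inv] in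
      \<open>simp_all add: o_def linear_id[unfolded id_def] grade_inv_blade linear_scale[OF linear_grade_inv]\<close>)

lemma sym_diff_singleton: "sym_diff S {i} = (if i \<in> S then S - {i} else insert i S)"
  "sym_diff {i} S = (if i \<in> S then S - {i} else insert i S)"
  by auto

lemma minus_one_power_card_sym_diff:
  "(-1 :: real) ^ card (sym_diff S {i}) = - ((-1) ^ card S)" for S :: "'a::finite set"
proof (cases "i \<in> S")
  case True
  then have "card S = Suc (card (S - {i}))" by (metis card_Suc_Diff1 finite)
  then have "(-1 :: real) ^ card S = - ((-1) ^ card (S - {i}))"
    by (metis power_Suc mult_minus1)
  with True show ?thesis by (simp only: sym_diff_singleton if_True minus_minus)
qed (simp add: sym_diff_singleton)

lemma grade_inv_mult_blade:
  "grade_inv (blade S * blade {i}) = - (grade_inv (blade S) * blade {i})"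
  "grade_inv (blade {i} * blade S) = - (blade {i} * grade_inv (blade S))"
proof -
  have c: "sym_diff {i} S = sym_diff S {i}" by auto
  show "grade_inv (blade S * blade {i}) = - (grade_inv (blade S) * blade {i})"
    by (simp only: blade_mult linear_scale[OF linear_grade_inv] grade_inv_blade
     minus_one_power_card_sym_diff) (simp add: blade_mult mult.commute)
  show "grade_inv (blade {i} * blade S) = - (blade {i} * grade_inv (blade S))"
    by (simp only: blade_mult c linear_scale[OF linear_grade_inv] grade_inv_blade
     minus_one_power_card_sym_diff) (simp add: blade_mult c mult.commute)
qed

lemma bilinear_eq_on_blades_axes:
  fixes F G :: "'n::{finite,linorder} multivector \<Rightarrow> real ^ 'n::{finite,linorder} \<Rightarrow> 'b::real_vector"
  assumes "bilinear F" "bilinear G" "\<And>S i. F (blade S) (axis i 1) = G (blade S) (axis i 1)"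
  shows "F A u = G A u"
proof (rule linear_eq_on_blades)
  show "linear (\<lambda>A. F A u)" "linear (\<lambda>A. G A u)"
    using assms(1,2) by (auto simp: bilinear_def)
  show "F (blade S) u = G (blade S) u" for S
    by (rule linear_eq_on_axes) (use assms in \<open>auto simp: bilinear_def\<close>)
qed

lemmas grade_inv_linear_simps = linear_add[OF linear_grade_inv] linear_scale[OF linear_grade_inv]
  linear_neg[OF linear_grade_inv] linear_diff[OF linear_grade_inv]
lemmas mvec_linear_simps = linear_add[OF linear_mvec] linear_scale[OF linear_mvec]

lemma grade_inv_mult_mvec:
  "grade_inv (A * mvec u) = - (grade_inv A * mvec u)"
  "grade_inv (mvec u * A) = - (mvec u * grade_inv A)"
  by (rule bilinear_eq_on_blades_axes; simp add: bilinear_def linear_iff grade_inv_linear_simps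
      mvec_linear_simps algebra_simps mvec_axis grade_inv_mult_blade)+

lemma linear_grade_part: "linear (grade_part r)"
  by (simp add: linear_iff grade_part_def plus_multivector.rep_eq scaleR_multivector.rep_eq
      algebra_simps sum.distrib scaleR_sum_right)

lemma grade_part_blade: "grade_part r (blade S) = (if card S = r then blade S else 0)"
proof -
  have "grade_part r (blade S) = (\<Sum>T | card T = r. if S = T then blade S else 0)"
    unfolding grade_part_def coeffs_blade by (rule sum.cong) auto
  then show ?thesis by simp
qed

lemma bilinear_outer: "bilinear (\<^bold>\<and>)"
  by (simp add: bilinear_def linear_iff outer_def linear_add[OF linear_grade_part]
   linear_scale[OF linear_grade_part] algebra_simps sum.distrib scaleR_sum_right)

lemma bilinear_outer_mvec:
  "bilinear (\<lambda>(A :: 'n::{finite,linorder} multivector) u. A \<^bold>\<and> mvec u)"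
  using bilinear_outer linear_compose[OF linear_mvec] by (fastforce simp: bilinear_def o_def)

lemma outer_blade:
  "blade S \<^bold>\<and> blade T = grade_part (card S + card T) (blade S * blade T)"
proof -
  have le: "card V \<le> CARD('a)" for V :: "'a set" by (simp add: card_mono)
  have "blade S \<^bold>\<and> blade T = (\<Sum>r\<le>CARD('a). \<Sum>s\<le>CARD('a).
    if r = card S then (if s = card T then grade_part (card S + card T) (blade S * blade T) else 0) else 0)"
    unfolding outer_def by (intro sum.cong refl)
      (auto simp: grade_part_blade linear_0[OF linear_grade_part])
  also have "\<dots> = (\<Sum>r\<le>CARD('a). if r = card S then grade_part (card S + card T) (blade S * blade T) else 0)"
    by (intro sum.cong refl) (simp add: le)
  finally show ?thesis by (simp add: le)
qed

text \<open>
  Moving \<open>e\<^sub>i\<close> across \<open>e\<^sub>S\<close> passes every factor of \<open>e\<^sub>S\<close>, each with a change of sign, except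
  \<open>e\<^sub>i\<close> itself.
\<close>

lemma blade_commute_singleton:
  fixes S :: "'n::{finite,linorder} set"
  shows "blade {i} * blade S = (if i \<in> S then - ((-1) ^ card S) else (-1) ^ card S) *\<^sub>R (blade S * blade {i})"
proof -
  have c: "sym_diff {i} S = sym_diff S {i}" by auto
  have one: "(\<Prod>j\<in>S. if j < i then -1 else 1 :: real) * (\<Prod>j\<in>S. if i < j then -1 else 1)
    = (-1) ^ card (S - {i})"
  proof -
    have "(\<Prod>j\<in>S. if j < i then -1 else 1 :: real) * (\<Prod>j\<in>S. if i < j then -1 else 1)
      = (\<Prod>j\<in>S. if j = i then 1 else -1)"
      unfolding prod.distrib[symmetric] by (rule prod.cong) (auto simp: neq_iff)
    also have "\<dots> = (\<Prod>j\<in>S-{i}. -1)"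
      by (rule prod.mono_neutral_cong_right) auto
    finally show ?thesis by simp
  qed
  have sq: "(\<Prod>j\<in>S. if i < j then -1 else 1 :: real) * (\<Prod>j\<in>S. if i < j then -1 else 1) = 1"
    unfolding prod.distrib[symmetric] by (rule prod.neutral) auto
  have "reorder_sign {i} S * reorder_sign S {i} = (-1) ^ card (S - {i})"
    using one by (simp add: reorder_sign_def)
  moreover have "reorder_sign S {i} * reorder_sign S {i} = 1"
    using sq by (simp add: reorder_sign_def)
  ultimately have "reorder_sign {i} S = (-1) ^ card (S - {i}) * reorder_sign S {i}"
    by (metis mult.assoc mult.right_neutral)
  moreover have "(-1) ^ card (S - {i}) = (if i \<in> S then - ((-1) ^ card S) else (-1 :: real) ^ card S)"
    using minus_one_power_card_sym_diff[of S i] by (auto simp: sym_diff_singleton)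
  ultimately show ?thesis by (simp only: blade_mult c scaleR_scaleR)
qed

text \<open>
  On a blade \<open>e\<^sub>S\<close> and \<open>e\<^sub>i\<close> the two summands are equal if \<open>i \<notin> S\<close>, where the geometric
  product already has the top grade, and cancel if \<open>i \<in> S\<close>, where it has lower grade.
\<close>

lemma outer_mvec_eq: "A \<^bold>\<and> mvec u = (1/2) *\<^sub>R (A * mvec u + mvec u * grade_inv A)"
  for A :: "'n::{finite,linorder} multivector"
proof (rule bilinear_eq_on_blades_axes[where F = "\<lambda>A u. A \<^bold>\<and> mvec u"
      and G = "\<lambda>A u. (1/2) *\<^sub>R (A * mvec u + mvec u * grade_inv A)"])
  show "bilinear (\<lambda>A u. A \<^bold>\<and> mvec u)"
    by (rule bilinear_outer_mvec)
  show "bilinear (\<lambda>A u. (1/2) *\<^sub>R (A * mvec u + mvec u * grade_inv A))"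
    by (simp add: bilinear_def linear_iff grade_inv_linear_simps mvec_linear_simps algebra_simps)
  fix S :: "'n set" and i
  have "blade S \<^bold>\<and> blade {i} = (if i \<in> S then 0 else blade S * blade {i})"
  proof (cases "i \<in> S")
    case True
    then have "card S = Suc (card (S - {i}))" by (metis card_Suc_Diff1 finite)
    then show ?thesis using True by (simp add: outer_blade blade_mult sym_diff_singleton
      linear_scale[OF linear_grade_part] grade_part_blade)
  next
    case False
    then show ?thesis by (simp add: outer_blade blade_mult sym_diff_singleton
      linear_scale[OF linear_grade_part] grade_part_blade)
  qed
  moreover have "blade {i} * grade_inv (blade S) = (if i \<in> S then - 1 else 1) *\<^sub>R (blade S * blade {i})"
    by (simp add: grade_inv_blade blade_commute_singleton power_mult_distrib[symmetric])
  ultimately show "blade S \<^bold>\<and> mvec (axis i 1)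
    = (1/2) *\<^sub>R (blade S * mvec (axis i 1) + mvec (axis i 1) * grade_inv (blade S))"
    by (simp add: mvec_axis scaleR_2[symmetric])
qed

text \<open>
  The part of \<open>A u\<close> that lowers the grade, that is, the right contraction of \<open>A\<close> by the vector \<open>u\<close>.
\<close>

definition contract :: "'n::{finite,linorder} multivector \<Rightarrow> real ^ 'n::{finite,linorder} \<Rightarrow> 'n multivector"
  where "contract A u = A * mvec u - A \<^bold>\<and> mvec u"

lemma contract_eq: "contract A u = (1/2) *\<^sub>R (A * mvec u - mvec u * grade_inv A)"
proof -
  have "(1/2) *\<^sub>R (A * mvec u - mvec u * grade_inv A) + A \<^bold>\<and> mvec u = (1/2) *\<^sub>R (A * mvec u + A * mvec u)"
    unfolding outer_mvec_eq by (simp only: scaleR_add_right[symmetric]) simp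
  then show ?thesis
    by (simp only: contract_def scaleR_half_double diff_eq_eq)
qed

text \<open>
  After symmetrization in \<open>u\<close> and \<open>v\<close> only the commutator of \<open>A\<close> with \<open>uv + vu\<close> remains, and
  \<open>uv + vu\<close> is a scalar.
\<close>

lemma outer_mvec_anticommute: "A \<^bold>\<and> mvec u \<^bold>\<and> mvec v = - (A \<^bold>\<and> mvec v \<^bold>\<and> mvec u)"
proof -
  have "A \<^bold>\<and> mvec u \<^bold>\<and> mvec v + A \<^bold>\<and> mvec v \<^bold>\<and> mvec u
   = (1/4) *\<^sub>R (A * (mvec u * mvec v + mvec v * mvec u) - (mvec u * mvec v + mvec v * mvec u) * A)"
    by (simp add: outer_mvec_eq grade_inv_linear_simps grade_inv_mult_mvec grade_inv_grade_inv
       algebra_simps)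
  also have "\<dots> = 0" by (simp only: mvec_polarization) simp
  finally show ?thesis by (simp add: eq_neg_iff_add_eq_0)
qed

text \<open>
  The antiderivation property, from which the contraction of a product of vectors follows factor by
  factor.
\<close>

lemma contract_outer: "contract (A \<^bold>\<and> mvec u) v = (u \<bullet> v) *\<^sub>R A - contract A v \<^bold>\<and> mvec u"
proof -
  have "contract (A \<^bold>\<and> mvec u) v + contract A v \<^bold>\<and> mvec u
   = (1/4) *\<^sub>R (A * (mvec u * mvec v + mvec v * mvec u) + (mvec u * mvec v + mvec v * mvec u) * A)"
    by (simp add: outer_mvec_eq contract_eq grade_inv_linear_simps grade_inv_mult_mvec grade_inv_grade_inv
       algebra_simps)
  also have "\<dots> = (u \<bullet> v) *\<^sub>R A" by (simp only: mvec_polarization) (simp flip: scaleR_add_left)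
  finally show ?thesis by (simp add: eq_diff_eq)
qed

section \<open>Cofactors of an outer product of vectors\<close>

lemma bounded_bilinear_outer_mvec:
  "bounded_bilinear (\<lambda>(A :: 'n::{finite,linorder} multivector) u. A \<^bold>\<and> mvec u)"
  using bilinear_outer_mvec bilinear_conv_bounded_bilinear by blast

interpretation outer_mvec: bounded_bilinear "\<lambda>(A :: 'n::{finite,linorder} multivector) u. A \<^bold>\<and> mvec u"
  by (rule bounded_bilinear_outer_mvec)

interpretation times_multivector: bounded_bilinear
   "(*) :: 'n::{finite,linorder} multivector \<Rightarrow> 'n multivector \<Rightarrow> 'n multivector"
  using bilinear_times_multivector bilinear_conv_bounded_bilinear by blast

text \<open>
  The head of the list is the last factor, in agreement with the left-nested products of
  \<^const>\<open>tangent_kvector\<close>.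
\<close>

primrec wedge :: "('k \<Rightarrow> real ^ 'n::{finite,linorder}) \<Rightarrow> 'k list \<Rightarrow> 'n multivector" where
  "wedge v [] = 1"
| "wedge v (l # L) = wedge v L \<^bold>\<and> mvec (v l)"

text \<open>
  The coefficient of \<open>v\<^sub>i \<bullet> w\<close> in the contraction of the outer product by \<open>w\<close>: the outer product
  without its factor \<open>v\<^sub>i\<close>, with one change of sign for each factor to the right of \<open>v\<^sub>i\<close>.
\<close>

primrec cofactor :: "('k \<Rightarrow> real ^ 'n::{finite,linorder}) \<Rightarrow> 'k list \<Rightarrow> 'k \<Rightarrow> 'n multivector" where
  "cofactor v [] i = 0"
| "cofactor v (l # L) i = (if i = l then wedge v L else - (cofactor v L i \<^bold>\<and> mvec (v l)))"

lemma foldl_outer_eq_wedge: "foldl (\<^bold>\<and>) 1 (map (\<lambda>i. mvec (v i)) L) = wedge v (rev L)"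
  by (induction L rule: rev_induct) auto

lemma outer_mvec_twice: "A \<^bold>\<and> mvec u \<^bold>\<and> mvec u = 0"
proof -
  have "2 *\<^sub>R (A \<^bold>\<and> mvec u \<^bold>\<and> mvec u) = 0"
    using outer_mvec_anticommute[of A u u] by (simp only: scaleR_2 eq_neg_iff_add_eq_0)
  then show ?thesis by simp
qed

lemma wedge_outer_member: "i \<in> set L \<Longrightarrow> wedge v L \<^bold>\<and> mvec (v i) = 0"
proof (induction L)
  case (Cons l L)
  show ?case
  proof (cases "i = l")
    case False
    with Cons have "wedge v L \<^bold>\<and> mvec (v i) = 0" by simp
    then show ?thesis
      using outer_mvec_anticommute[of "wedge v L" "v l" "v i"] by (simp add: outer_mvec.zero_left)
  qed (simp add: outer_mvec_twice)
qed simp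

lemma contract_one: "contract 1 w = 0"
  by (simp add: contract_eq one_multivector_def grade_inv_blade)
   (simp flip: one_multivector_def)

lemma contract_wedge:
  "distinct L \<Longrightarrow> contract (wedge v L) w = (\<Sum>i\<in>set L. (v i \<bullet> w) *\<^sub>R cofactor v L i)"
proof (induction L)
  case (Cons l L)
  have "(\<Sum>i\<in>set L. (v i \<bullet> w) *\<^sub>R cofactor v (l # L) i)
    = (\<Sum>i\<in>set L. - (((v i \<bullet> w) *\<^sub>R cofactor v L i) \<^bold>\<and> mvec (v l)))"
    using Cons.prems by (intro sum.cong) (auto simp: outer_mvec.scaleR_left)
  then show ?case
    using Cons by (simp add: contract_outer sum_negf outer_mvec.sum_left)
qed (simp add: contract_one)

text \<open>
  The outer part of the product vanishes because \<open>w\<close> lies in the span of the factors; in the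
  contraction only the term of \<open>v\<^sub>i\<close> survives.
\<close>

lemma wedge_mult_reciprocal:
  assumes "distinct L" "i \<in> set L" "w \<in> span (v ` set L)"
    and "\<And>j. j \<in> set L \<Longrightarrow> v j \<bullet> w = (if i = j then 1 else 0)"
  shows "wedge v L * mvec w = cofactor v L i"
proof -
  have "wedge v L \<^bold>\<and> mvec w = (\<lambda>_. 0) w"
    by (rule linear_eq_on_span[where f = "\<lambda>w. wedge v L \<^bold>\<and> mvec w", OF _ _ _ assms(3)])
      (auto simp: linear_iff outer_mvec.add_right outer_mvec.scaleR_right wedge_outer_member)
  moreover have "contract (wedge v L) w = (\<Sum>j\<in>set L. if j = i then cofactor v L i else 0)"
    unfolding contract_wedge[OF assms(1)] by (rule sum.cong) (auto simp: assms(4))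
  ultimately show ?thesis
    using assms(2) by (simp add: contract_def)
qed

text \<open>
  The derivative of \<^const>\<open>cofactor\<close> when the vectors \<open>v\<^sub>j\<close> move with velocities \<open>q\<^sub>j\<close>.  In the branch
  \<open>i = l\<close> this is the derivative of the outer product of the remaining factors.
\<close>

primrec cofactor_deriv ::
    "('k \<Rightarrow> real ^ 'n::{finite,linorder}) \<Rightarrow> ('k \<Rightarrow> real ^ 'n::{finite,linorder}) \<Rightarrow> 'k list \<Rightarrow> 'k \<Rightarrow> 'n multivector" where
  "cofactor_deriv v q [] i = 0"
| "cofactor_deriv v q (l # L) i =
    (if i = l then \<Sum>j\<in>set L. cofactor v L j \<^bold>\<and> mvec (q j)
     else - (cofactor v L i \<^bold>\<and> mvec (q l) + cofactor_deriv v q L i \<^bold>\<and> mvec (v l)))"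

text \<open>
  The sum \<open>\<Sum>\<^sub>j cofactor\<^sub>j \<and> q\<^sub>j\<close> satisfies the product rule for appending a factor, so it is the derivative
  of the outer product.  The sign in \<^const>\<open>cofactor\<close> is absorbed by exchanging \<open>q\<^sub>j\<close> with \<open>v\<^sub>l\<close>.
\<close>

lemma wedge_deriv_Cons:
  assumes "distinct (l # L)"
  shows "(\<Sum>j\<in>set (l # L). cofactor v (l # L) j \<^bold>\<and> mvec (q j))
    = wedge v L \<^bold>\<and> mvec (q l) + (\<Sum>j\<in>set L. cofactor v L j \<^bold>\<and> mvec (q j)) \<^bold>\<and> mvec (v l)"
proof -
  have "(\<Sum>j\<in>set L. cofactor v (l # L) j \<^bold>\<and> mvec (q j))
    = (\<Sum>j\<in>set L. cofactor v L j \<^bold>\<and> mvec (q j) \<^bold>\<and> mvec (v l))"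
  proof (rule sum.cong[OF refl])
    fix j assume "j \<in> set L"
    with assms have "j \<noteq> l" by auto
    then show "cofactor v (l # L) j \<^bold>\<and> mvec (q j) = cofactor v L j \<^bold>\<and> mvec (q j) \<^bold>\<and> mvec (v l)"
      using outer_mvec_anticommute[of "cofactor v L j" "v l" "q j"] by (simp add: outer_mvec.minus_left)
  qed
  with assms show ?thesis by (simp add: outer_mvec.sum_left)
qed

text \<open>
  \<open>H i j\<close> stands for \<open>\<partial>\<^sub>i v\<^sub>j\<close>.  Appending a factor \<open>v\<^sub>l\<close> adds the derivative of the old product in
  direction \<open>l\<close>, which is \<open>\<Sum>\<^sub>i cofactor\<^sub>i \<and> H l i\<close>, and subtracts \<open>\<Sum>\<^sub>i cofactor\<^sub>i \<and> H i l\<close>; symmetry of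
  \<open>H\<close> makes these cancel, and the old sum vanishes by induction.
\<close>

lemma sum_cofactor_deriv_eq_0:
  assumes "distinct L" "\<And>i j. H i j = H j i"
  shows "(\<Sum>i\<in>set L. cofactor_deriv v (H i) L i) = 0"
  using assms(1)
proof (induction L)
  case (Cons l L)
  have "(\<Sum>i\<in>set L. cofactor_deriv v (H i) (l # L) i)
    = (\<Sum>i\<in>set L. - (cofactor v L i \<^bold>\<and> mvec (H l i) + cofactor_deriv v (H i) L i \<^bold>\<and> mvec (v l)))"
  proof (rule sum.cong[OF refl])
    fix i assume "i \<in> set L"
    with Cons.prems have "i \<noteq> l" by auto
    then show "cofactor_deriv v (H i) (l # L) i
        = - (cofactor v L i \<^bold>\<and> mvec (H l i) + cofactor_deriv v (H i) L i \<^bold>\<and> mvec (v l))"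
      by (simp only: cofactor_deriv.simps if_False assms(2)[of i l])
  qed
  also have "\<dots> = - ((\<Sum>i\<in>set L. cofactor v L i \<^bold>\<and> mvec (H l i))
      + (\<Sum>i\<in>set L. cofactor_deriv v (H i) L i) \<^bold>\<and> mvec (v l))"
    by (simp only: sum_negf sum.distrib outer_mvec.sum_left)
  finally show ?case
    using Cons by (simp add: outer_mvec.zero_left)
qed simp

lemma wedge_has_derivative:
  assumes "distinct L" "\<And>j. ((\<lambda>s. v s j) has_derivative (\<lambda>d. q d j)) (at s within R)"
  shows "((\<lambda>s. wedge (v s) L) has_derivative
    (\<lambda>d. \<Sum>j\<in>set L. cofactor (v s) L j \<^bold>\<and> mvec (q d j))) (at s within R)"
  using assms(1)
proof (induction L)
  case (Cons l L)
  from outer_mvec.FDERIV[OF Cons.IH assms(2)[of l]] Cons.prems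
  have "((\<lambda>s. wedge (v s) (l # L)) has_derivative (\<lambda>d. wedge (v s) L \<^bold>\<and> mvec (q d l)
     + (\<Sum>j\<in>set L. cofactor (v s) L j \<^bold>\<and> mvec (q d j)) \<^bold>\<and> mvec (v s l))) (at s within R)"
    by simp
  then show ?case
    by (simp only: wedge_deriv_Cons[OF Cons.prems])
qed simp

lemma cofactor_has_derivative:
  assumes "distinct L" "\<And>j. ((\<lambda>s. v s j) has_derivative (\<lambda>d. q d j)) (at s within R)"
  shows "((\<lambda>s. cofactor (v s) L i) has_derivative (\<lambda>d. cofactor_deriv (v s) (q d) L i)) (at s within R)"
  using assms(1)
proof (induction L)
  case (Cons l L)
  show ?case
  proof (cases "i = l")
    case True
    then show ?thesis
      using wedge_has_derivative[of L, OF _ assms(2)] Cons.prems by simp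
  next
    case False
    with has_derivative_minus[OF outer_mvec.FDERIV[OF Cons.IH assms(2)[of l]]] Cons.prems
    show ?thesis by simp
  qed
qed simp

lemma continuous_on_wedge:
  assumes "\<And>j. continuous_on R (\<lambda>s. v s j)"
  shows "continuous_on R (\<lambda>s. wedge (v s) L)"
  by (induction L) (auto intro!: outer_mvec.continuous_on assms)

lemma continuous_on_cofactor:
  assumes "\<And>j. continuous_on R (\<lambda>s. v s j)"
  shows "continuous_on R (\<lambda>s. cofactor (v s) L i)"
proof (induction L)
  case (Cons l L)
  then show ?case
    by (cases "i = l") (auto intro!: outer_mvec.continuous_on assms continuous_on_wedge continuous_on_minus)
qed simp

lemma continuous_on_cofactor_deriv:
  assumes "\<And>j. continuous_on R (\<lambda>s. v s j)" "\<And>j. continuous_on R (\<lambda>s. q s j)"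
  shows "continuous_on R (\<lambda>s. cofactor_deriv (v s) (q s) L i)"
proof (induction L)
  case (Cons l L)
  then show ?case
    by (cases "i = l") (auto intro!: outer_mvec.continuous_on assms continuous_on_cofactor
      continuous_on_minus continuous_on_diff continuous_on_sum)
qed simp

section \<open>Symmetry of second derivatives on a closed box\<close>

text \<open>
  The second difference over a small parallelogram is a value of the mixed derivative near \<open>p\<close>, by
  the mean value theorem in direction \<open>u\<close> and then in direction \<open>v\<close>.  Only points of the parallelogram
  are used, so \<open>p\<close> may lie on the boundary of \<open>S\<close>.
\<close>

lemma second_difference_mvt:
  fixes h :: "'a::real_normed_vector \<Rightarrow> real"
  assumes e: "0 < e" "e \<le> 1"
    and S: "\<And>c d. c \<in> {0..1} \<Longrightarrow> d \<in> {0..1} \<Longrightarrow> p + c *\<^sub>R u + d *\<^sub>R v \<in> S"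
    and h': "\<And>s. s \<in> S \<Longrightarrow> (h has_derivative h' s) (at s within S)"
    and hu: "\<And>s. s \<in> S \<Longrightarrow> ((\<lambda>s. h' s u) has_derivative hu s) (at s within S)"
  shows "\<exists>c\<in>{0..e}. \<exists>d\<in>{0..e}. h (p + e *\<^sub>R u + e *\<^sub>R v) - h (p + e *\<^sub>R u) - h (p + e *\<^sub>R v) + h p
    = e * e * hu (p + c *\<^sub>R u + d *\<^sub>R v) v"
proof -
  have der: "((\<lambda>c. h (p + c *\<^sub>R u + d *\<^sub>R v)) has_derivative (\<lambda>t. t * h' (p + c *\<^sub>R u + d *\<^sub>R v) u))
      (at c within {0..e})" if "c \<in> {0..e}" "d \<in> {0..e}" for c d
  proof -
    have "((\<lambda>c. h (p + c *\<^sub>R u + d *\<^sub>R v)) has_derivative (\<lambda>t. h' (p + c *\<^sub>R u + d *\<^sub>R v) (t *\<^sub>R u)))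
      (at c within {0..e})"
      by (rule has_derivative_in_compose2[where f = "\<lambda>c. p + c *\<^sub>R u + d *\<^sub>R v" and t = S and g = h])
        (use that e in \<open>auto intro!: S h' derivative_eq_intros\<close>)
    moreover have "linear (h' (p + c *\<^sub>R u + d *\<^sub>R v))"
      by (rule has_derivative_linear[OF h']) (use that e S in auto)
    ultimately show ?thesis by (simp add: linear_scale)
  qed
  have "\<exists>c\<in>{0<..<e}. (h (p + e *\<^sub>R u + e *\<^sub>R v) - h (p + e *\<^sub>R u + 0 *\<^sub>R v))
      - (h (p + 0 *\<^sub>R u + e *\<^sub>R v) - h (p + 0 *\<^sub>R u + 0 *\<^sub>R v))
    = (e - 0) * h' (p + c *\<^sub>R u + e *\<^sub>R v) u - (e - 0) * h' (p + c *\<^sub>R u + 0 *\<^sub>R v) u"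
  proof (rule mvt_simple[OF e(1), where f = "\<lambda>c. h (p + c *\<^sub>R u + e *\<^sub>R v) - h (p + c *\<^sub>R u + 0 *\<^sub>R v)"])
    fix c assume "0 \<le> c" "c \<le> e"
    then show "((\<lambda>c. h (p + c *\<^sub>R u + e *\<^sub>R v) - h (p + c *\<^sub>R u + 0 *\<^sub>R v)) has_derivative
      (\<lambda>t. t * h' (p + c *\<^sub>R u + e *\<^sub>R v) u - t * h' (p + c *\<^sub>R u + 0 *\<^sub>R v) u)) (at c within {0..e})"
      using e by (intro has_derivative_diff der) auto
  qed
  then obtain c where c: "c \<in> {0<..<e}" and
    eq1: "h (p + e *\<^sub>R u + e *\<^sub>R v) - h (p + e *\<^sub>R u) - h (p + e *\<^sub>R v) + h p
      = e * (h' (p + c *\<^sub>R u + e *\<^sub>R v) u - h' (p + c *\<^sub>R u + 0 *\<^sub>R v) u)"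
    by (auto simp: algebra_simps)
  have "\<exists>d\<in>{0<..<e}. h' (p + c *\<^sub>R u + e *\<^sub>R v) u - h' (p + c *\<^sub>R u + 0 *\<^sub>R v) u
      = (\<lambda>t. hu (p + c *\<^sub>R u + d *\<^sub>R v) (t *\<^sub>R v)) (e - 0)"
  proof (rule mvt_simple[OF e(1)])
    fix d assume "0 \<le> d" "d \<le> e"
    then show "((\<lambda>d. h' (p + c *\<^sub>R u + d *\<^sub>R v) u) has_derivative (\<lambda>t. hu (p + c *\<^sub>R u + d *\<^sub>R v) (t *\<^sub>R v)))
        (at d within {0..e})"
      using c e
      by (intro has_derivative_in_compose2[where f = "\<lambda>d. p + c *\<^sub>R u + d *\<^sub>R v" and t = S and g = "\<lambda>s. h' s u"])
       (auto intro!: S hu derivative_eq_intros)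
  qed
  then obtain d where d: "d \<in> {0<..<e}" and
    eq2: "h' (p + c *\<^sub>R u + e *\<^sub>R v) u - h' (p + c *\<^sub>R u + 0 *\<^sub>R v) u = hu (p + c *\<^sub>R u + d *\<^sub>R v) (e *\<^sub>R v)"
    by auto
  have "linear (hu (p + c *\<^sub>R u + d *\<^sub>R v))"
    by (rule has_derivative_linear[OF hu]) (use c d e S in auto)
  then have "h (p + e *\<^sub>R u + e *\<^sub>R v) - h (p + e *\<^sub>R u) - h (p + e *\<^sub>R v) + h p
    = e * e * hu (p + c *\<^sub>R u + d *\<^sub>R v) v"
    unfolding eq1 eq2 by (simp add: linear_scale)
  with c d show ?thesis
    by (meson greaterThanLessThan_subseteq_atLeastAtMost_iff order_refl subset_iff)
qed

text \<open>
  The second difference is symmetric in \<open>u\<close> and \<open>v\<close>, so both orders of differentiation agree at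
  points arbitrarily close to \<open>p\<close>, and by continuity at \<open>p\<close>.
\<close>

lemma second_derivative_symmetric_real:
  fixes h :: "'a::real_normed_vector \<Rightarrow> real"
  assumes S: "\<And>c d. c \<in> {0..1} \<Longrightarrow> d \<in> {0..1} \<Longrightarrow> p + c *\<^sub>R u + d *\<^sub>R v \<in> S"
    and h': "\<And>s. s \<in> S \<Longrightarrow> (h has_derivative h' s) (at s within S)"
    and hu: "\<And>s. s \<in> S \<Longrightarrow> ((\<lambda>s. h' s u) has_derivative hu s) (at s within S)"
    and hv: "\<And>s. s \<in> S \<Longrightarrow> ((\<lambda>s. h' s v) has_derivative hv s) (at s within S)"
    and cont: "continuous_on S (\<lambda>s. hu s v)" "continuous_on S (\<lambda>s. hv s u)"
  shows "hu p v = hv p u"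
proof -
  define e where "e n = 1 / real (Suc n)" for n
  have e: "0 < e n" "e n \<le> 1" for n by (auto simp: e_def)
  have e0: "e \<longlonglongrightarrow> 0" unfolding e_def by (rule LIMSEQ_Suc[OF lim_1_over_n])
  have "\<exists>c d c' d'. c \<in> {0..e n} \<and> d \<in> {0..e n} \<and> c' \<in> {0..e n} \<and> d' \<in> {0..e n} \<and>
     hu (p + c *\<^sub>R u + d *\<^sub>R v) v = hv (p + c' *\<^sub>R u + d' *\<^sub>R v) u" for n
  proof -
    obtain c d where 1: "c \<in> {0..e n}" "d \<in> {0..e n}"
      "h (p + e n *\<^sub>R u + e n *\<^sub>R v) - h (p + e n *\<^sub>R u) - h (p + e n *\<^sub>R v) + h p
        = e n * e n * hu (p + c *\<^sub>R u + d *\<^sub>R v) v"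
      using second_difference_mvt[OF e S h' hu] by meson
    have S': "p + c *\<^sub>R v + d *\<^sub>R u \<in> S" if "c \<in> {0..1}" "d \<in> {0..1}" for c d
      using S[OF that(2,1)] by (simp add: algebra_simps)
    obtain d' c' where 2: "d' \<in> {0..e n}" "c' \<in> {0..e n}"
      "h (p + e n *\<^sub>R v + e n *\<^sub>R u) - h (p + e n *\<^sub>R v) - h (p + e n *\<^sub>R u) + h p
        = e n * e n * hv (p + d' *\<^sub>R v + c' *\<^sub>R u) u"
      using second_difference_mvt[OF e S' h' hv] by meson
    have swap: "p + e n *\<^sub>R v + e n *\<^sub>R u = p + e n *\<^sub>R u + e n *\<^sub>R v" "p + d' *\<^sub>R v + c' *\<^sub>R u = p + c' *\<^sub>R u + d' *\<^sub>R v"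
      by (simp_all add: algebra_simps)
    have "e n * e n * hu (p + c *\<^sub>R u + d *\<^sub>R v) v = e n * e n * hv (p + c' *\<^sub>R u + d' *\<^sub>R v) u"
      using 1(3) 2(3) unfolding swap by linarith
    then have "hu (p + c *\<^sub>R u + d *\<^sub>R v) v = hv (p + c' *\<^sub>R u + d' *\<^sub>R v) u"
      using e(1)[of n] by simp
    with 1 2 show ?thesis by blast
  qed
  then obtain c d c' d' where m: "\<And>n. c n \<in> {0..e n}" "\<And>n. d n \<in> {0..e n}"
      "\<And>n. c' n \<in> {0..e n}" "\<And>n. d' n \<in> {0..e n}"
    and eq: "\<And>n. hu (p + c n *\<^sub>R u + d n *\<^sub>R v) v = hv (p + c' n *\<^sub>R u + d' n *\<^sub>R v) u"
    by metis
  have z: "t \<longlonglongrightarrow> 0" if "\<And>n. t n \<in> {0..e n}" for t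
    by (rule tendsto_sandwich[OF _ _ tendsto_const e0]) (use that in auto)
  have lim: "(\<lambda>n. p + t n *\<^sub>R u + r n *\<^sub>R v) \<longlonglongrightarrow> p"
    if "\<And>n. t n \<in> {0..e n}" "\<And>n. r n \<in> {0..e n}" for t r
    using tendsto_add[OF tendsto_add[OF tendsto_const tendsto_scaleR[OF z[OF that(1)] tendsto_const]]
        tendsto_scaleR[OF z[OF that(2)] tendsto_const], of p u v] by simp
  have inS: "p + t n *\<^sub>R u + r n *\<^sub>R v \<in> S"
    if "\<And>n. t n \<in> {0..e n}" "\<And>n. r n \<in> {0..e n}" for t r n
    using that[of n] e(2)[of n] by (intro S) auto
  have p: "p \<in> S" using S[of 0 0] by simp
  have "(\<lambda>n. hu (p + c n *\<^sub>R u + d n *\<^sub>R v) v) \<longlonglongrightarrow> hu p v"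
    by (rule continuous_on_tendsto_compose[OF cont(1) lim[OF m(1,2)] p]) (simp add: inS[OF m(1,2)])
  moreover have "(\<lambda>n. hv (p + c' n *\<^sub>R u + d' n *\<^sub>R v) u) \<longlonglongrightarrow> hv p u"
    by (rule continuous_on_tendsto_compose[OF cont(2) lim[OF m(3,4)] p]) (simp add: inS[OF m(3,4)])
  ultimately show ?thesis unfolding eq by (rule LIMSEQ_unique)
qed

text \<open>
  At a boundary point of the box the coordinate directions have to be replaced by multiples that
  point into the box.
\<close>

lemma second_derivative_symmetric_cbox:
  fixes x :: "real ^ 'k::finite \<Rightarrow> real ^ 'n::finite"
  assumes ab: "\<And>i. a $ i < b $ i"
    and x': "\<And>s. s \<in> cbox a b \<Longrightarrow> (x has_derivative x' s) (at s within cbox a b)"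
    and x'': "\<And>v s. s \<in> cbox a b \<Longrightarrow> ((\<lambda>s. x' s v) has_derivative x'' v s) (at s within cbox a b)"
    and cont: "\<And>v w. continuous_on (cbox a b) (\<lambda>s. x'' v s w)"
    and p: "p \<in> cbox a b"
  shows "x'' (axis i 1) p (axis j 1) = x'' (axis j 1) p (axis i 1)"
proof (cases "i = j")
  case False
  \<comment> \<open>The step \<open>r l\<close> along axis \<open>l\<close> leads to the middle of the box, or to a face if coordinate \<open>l\<close> of \<open>p\<close>
      is already in the middle, so that it is never 0.\<close>
  define m where "m = (1/2) *\<^sub>R (a + b)"
  define r where "r l = (if p $ l = m $ l then b $ l - p $ l else m $ l - p $ l)" for l
  have r0: "r l \<noteq> 0" for l
    using ab[of l] by (auto simp: r_def m_def field_simps)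
  have r: "a $ l \<le> p $ l + c * r l \<and> p $ l + c * r l \<le> b $ l" if "c \<in> {0..1}" for l c
  proof -
    have "p $ l + r l \<in> {a $ l..b $ l}" "p $ l \<in> {a $ l..b $ l}"
      using p ab[of l] by (auto simp: r_def m_def mem_box_cart field_simps)
    then have "(1 - c) *\<^sub>R (p $ l) + c *\<^sub>R (p $ l + r l) \<in> {a $ l..b $ l}"
      using that by (intro convexD_alt) auto
    then have "p $ l + c * r l \<in> {a $ l..b $ l}"
      by (simp add: algebra_simps)
    then show ?thesis by simp
  qed
  let ?u = "r i *\<^sub>R axis i 1 :: real ^ 'k" and ?v = "r j *\<^sub>R axis j 1 :: real ^ 'k"
  have S: "p + c *\<^sub>R ?u + d *\<^sub>R ?v \<in> cbox a b" if "c \<in> {0..1}" "d \<in> {0..1}" for c d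
    unfolding mem_box_cart
  proof
    fix l
    show "a $ l \<le> (p + c *\<^sub>R ?u + d *\<^sub>R ?v) $ l \<and> (p + c *\<^sub>R ?u + d *\<^sub>R ?v) $ l \<le> b $ l"
      using r[OF that(1), of i] r[OF that(2), of j] p False
      by (auto simp: axis_def mem_box_cart)
  qed
  have "x'' ?u p ?v $ l = x'' ?v p ?u $ l" for l
  proof (rule second_derivative_symmetric_real[OF S, where h = "\<lambda>s. x s $ l" and h' = "\<lambda>s d. x' s d $ l"
        and hu = "\<lambda>s d. x'' ?u s d $ l" and hv = "\<lambda>s d. x'' ?v s d $ l"])
    fix s assume "s \<in> cbox a b"
    then show "((\<lambda>s. x s $ l) has_derivative (\<lambda>d. x' s d $ l)) (at s within cbox a b)"
      "((\<lambda>s. x' s ?u $ l) has_derivative (\<lambda>d. x'' ?u s d $ l)) (at s within cbox a b)"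
      "((\<lambda>s. x' s ?v $ l) has_derivative (\<lambda>d. x'' ?v s d $ l)) (at s within cbox a b)"
      using bounded_linear.has_derivative[OF bounded_linear_vec_nth] x' x'' by blast+
  qed (auto intro!: continuous_on_component cont)
  then have eq: "x'' ?u p ?v = x'' ?v p ?u" by (simp add: vec_eq_iff)
  \<comment> \<open>Linearity in the first direction is inherited from the first derivative by uniqueness of derivatives on the box.\<close>
  have scale: "x'' (c *\<^sub>R v) p w = c *\<^sub>R x'' v p w" for c v w
  proof -
    have "((\<lambda>s. x' s (c *\<^sub>R v)) has_derivative (\<lambda>d. c *\<^sub>R x'' v p d)) (at p within cbox a b)"
    proof (rule has_derivative_transform[OF p])
      show "((\<lambda>s. c *\<^sub>R x' s v) has_derivative (\<lambda>d. c *\<^sub>R x'' v p d)) (at p within cbox a b)"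
        by (rule has_derivative_scaleR_right[OF x''[OF p]])
    qed (simp add: linear_scale[OF has_derivative_linear[OF x']])
    from frechet_derivative_unique_within_closed_interval[OF _ p this x''[OF p]]
    have "(\<lambda>d. c *\<^sub>R x'' v p d) = x'' (c *\<^sub>R v) p"
      using ab by (force simp: Basis_vec_def inner_axis)
    then show ?thesis by metis
  qed
  have "r j *\<^sub>R r i *\<^sub>R x'' (axis i 1) p (axis j 1) = r i *\<^sub>R r j *\<^sub>R x'' (axis j 1) p (axis i 1)"
    using eq by (simp only: scale linear_scale[OF has_derivative_linear[OF x''[OF p]]])
  then show ?thesis
    using r0[of i] r0[of j] by (simp add: mult.commute[of "r j"])
qed simp

section \<open>Integrating a partial derivative over a box\<close>

lemma set_coord_eq_line: "set_coord s i t = s + (t - s $ i) *\<^sub>R axis i 1"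
  by (simp add: set_coord_def vec_eq_iff axis_def)

lemma set_coord_mem_cbox:
  "s \<in> cbox a b \<Longrightarrow> set_coord s i t \<in> cbox a b \<longleftrightarrow> t \<in> {a $ i..b $ i}"
  by (auto simp: set_coord_def mem_box_cart)

lemma set_coord_self: "set_coord s i (s $ i) = s"
  by (simp add: set_coord_eq_line)

lemma has_vector_derivative_set_coord:
  assumes s: "s \<in> cbox a b" and t: "t \<in> {a $ i..b $ i}"
    and h': "(h has_derivative h') (at (set_coord s i t) within cbox a b)"
  shows "((\<lambda>t. h (set_coord s i t)) has_vector_derivative h' (axis i 1)) (at t within {a $ i..b $ i})"
proof -
  have img: "set_coord s i ` {a $ i..b $ i} \<subseteq> cbox a b"
    using s by (auto simp: set_coord_mem_cbox)
  have "(set_coord s i has_derivative (\<lambda>d. d *\<^sub>R axis i 1)) (at t within {a $ i..b $ i})"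
    unfolding set_coord_eq_line by (auto intro!: derivative_eq_intros)
  from has_derivative_in_compose[OF this has_derivative_subset[OF h' img]]
  show ?thesis
    by (simp add: has_vector_derivative_def o_def linear_scale[OF has_derivative_linear[OF h']])
qed

lemma partial_deriv_eq:
  assumes ab: "a $ i < b $ i" and s: "s \<in> cbox a b"
    and h': "(h has_derivative h') (at s within cbox a b)"
  shows "partial_deriv (cbox a b) h i s = h' (axis i 1)"
proof -
  have si: "s $ i \<in> {a $ i..b $ i}" using s by (simp add: mem_box_cart)
  have "{t. set_coord s i t \<in> cbox a b} = cbox (a $ i) (b $ i)"
    using s by (auto simp: set_coord_mem_cbox)
  moreover have "vector_derivative (\<lambda>t. h (set_coord s i t)) (at (s $ i) within cbox (a $ i) (b $ i)) = h' (axis i 1)"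
    using has_vector_derivative_set_coord[OF s si, of h h'] h' si
    by (intro vector_derivative_within_cbox[OF ab]) (simp_all add: set_coord_self)
  ultimately show ?thesis
    unfolding partial_deriv_def by simp
qed

interpretation lborel_prod: product_sigma_finite "\<lambda>_ :: 'k. lborel :: real measure"
  by standard

lemma measurable_vec_lambda_PiM:
  "(\<lambda>t. \<chi> j. t j) \<in> measurable (\<Pi>\<^sub>M j\<in>UNIV. lborel) (borel :: (real ^ 'k::finite) measure)"
  by (rule borel_measurable_euclidean_space[THEN iffD2])
   (auto simp: Basis_vec_def inner_axis intro!: measurable_component_singleton)

text \<open>
  Face integrals use product measures indexed by coordinates, whereas \<^const>\<open>lborel\<close> is defined from a
  product over the basis vectors.  The two are compared on open boxes.
\<close>

lemma lborel_vec_eq_distr: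
  "(lborel :: (real ^ 'k::finite) measure) = distr (\<Pi>\<^sub>M j\<in>UNIV. lborel) borel (\<lambda>t. \<chi> j. t j)"
proof (rule lborel_eqI)
  fix l u :: "real ^ 'k"
  assume lu: "\<And>b. b \<in> Basis \<Longrightarrow> l \<bullet> b \<le> u \<bullet> b"
  have le: "l $ j \<le> u $ j" for j
    using lu[of "axis j 1"] by (simp add: axis_in_Basis_iff inner_axis)
  have "(\<lambda>t. \<chi> j. t j) -` box l u \<inter> space (\<Pi>\<^sub>M j\<in>UNIV. lborel) = (\<Pi>\<^sub>E j\<in>UNIV. {l $ j<..<u $ j})"
    by (intro set_eqI) (simp add: mem_box_cart space_PiM PiE_iff)
  then have "emeasure (distr (\<Pi>\<^sub>M j\<in>UNIV. lborel) borel (\<lambda>t. \<chi> j. t j)) (box l u)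
     = (\<Prod>j\<in>UNIV. ennreal (u $ j - l $ j))"
    by (simp add: emeasure_distr measurable_vec_lambda_PiM lborel_prod.emeasure_PiM le)
  also have "\<dots> = (\<Prod>j\<in>UNIV. u $ j - l $ j)"
    using le by (intro prod_ennreal) simp
  also have "(\<Prod>j\<in>UNIV. u $ j - l $ j) = (\<Prod>b\<in>(\<lambda>j. axis j 1) ` UNIV. (u - l) \<bullet> b)"
    by (subst prod.reindex) (auto simp: inj_on_def axis_eq_axis inner_axis)
  also have "(\<lambda>j. axis j 1) ` UNIV = (Basis :: (real ^ 'k) set)"
    by (auto simp: Basis_vec_def)
  finally show "emeasure (distr (\<Pi>\<^sub>M j\<in>UNIV. lborel) borel (\<lambda>t. \<chi> j. t j)) (box l u)
    = ennreal (\<Prod>b\<in>Basis. (u - l) \<bullet> b)" .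
qed simp

definition face_point :: "'k \<Rightarrow> real \<Rightarrow> ('k \<Rightarrow> real) \<Rightarrow> real ^ 'k::finite"
  where "face_point i c t = (\<chi> j. if j = i then c else t j)"

lemma set_coord_face_point: "set_coord (face_point i c t) i y = face_point i y t"
  by (simp add: set_coord_def face_point_def vec_eq_iff)

lemma face_point_mem_cbox:
  assumes "t \<in> extensional (UNIV - {i})"
  shows "face_point i c t \<in> cbox a b \<longleftrightarrow>
    t \<in> (\<Pi>\<^sub>E j\<in>UNIV - {i}. {a $ j..b $ j}) \<and> c \<in> {a $ i..b $ i}"
  using assms by (auto simp: face_point_def mem_box_cart PiE_def Pi_iff split: if_splits)

lemma measurable_face_point:
  "face_point i c \<in> borel_measurable (\<Pi>\<^sub>M j\<in>UNIV - {i}. lborel)"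
proof (rule borel_measurable_euclidean_space[THEN iffD2], rule ballI)
  fix b :: "real ^ 'a" assume "b \<in> Basis"
  then obtain j where "b = axis j 1" by (auto simp: Basis_vec_def)
  then show "(\<lambda>t. face_point i c t \<bullet> b) \<in> borel_measurable (\<Pi>\<^sub>M j\<in>UNIV - {i}. lborel)"
    by (cases "j = i") (auto simp: face_point_def inner_axis intro!: measurable_component_singleton)
qed

lemma integrable_face:
  fixes h :: "real ^ 'k::finite \<Rightarrow> 'b::euclidean_space"
  assumes h: "continuous_on (cbox a b) h" and c: "c \<in> {a $ i..b $ i}"
  shows "set_integrable (\<Pi>\<^sub>M j\<in>UNIV - {i}. lborel) (\<Pi>\<^sub>E j\<in>UNIV - {i}. {a $ j..b $ j})
    (\<lambda>t. h (face_point i c t))"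
proof -
  let ?P = "\<Pi>\<^sub>M j\<in>UNIV - {i}. lborel :: real measure" and ?F = "\<Pi>\<^sub>E j\<in>UNIV - {i}. {a $ j..b $ j}"
  let ?h = "\<lambda>s. indicator (cbox a b) s *\<^sub>R h s"
  have F: "?F \<in> sets ?P" by (rule sets_PiM_I_finite) auto
  have "compact (h ` cbox a b)" by (rule compact_continuous_image[OF h compact_cbox])
  then obtain B where B: "\<And>s. s \<in> cbox a b \<Longrightarrow> norm (h s) \<le> B"
    using compact_imp_bounded bounded_iff by (metis imageI)
  have "?h \<in> borel_measurable borel"
    using borel_measurable_continuous_on_indicator[OF _ h] by simp
  then have meas: "(\<lambda>t. ?h (face_point i c t)) \<in> borel_measurable ?P"
    by (rule measurable_compose[OF measurable_face_point])
  have "emeasure ?P ?F = (\<Prod>j\<in>UNIV - {i}. emeasure lborel {a $ j..b $ j})"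
    by (rule lborel_prod.emeasure_PiM) auto
  also have "\<dots> = ennreal (\<Prod>j\<in>UNIV - {i}. max 0 (b $ j - a $ j))"
    by (subst prod_ennreal[symmetric]) (auto intro!: prod.cong simp: emeasure_lborel_Icc_eq max_def)
  also have "\<dots> < \<infinity>" by simp
  finally have fin: "emeasure ?P ?F < \<infinity>" .
  have mem: "face_point i c t \<in> cbox a b" if "t \<in> ?F" for t
    using that c by (subst face_point_mem_cbox) (auto simp: PiE_def)
  have "integrable ?P (\<lambda>t. indicator ?F t *\<^sub>R ?h (face_point i c t))"
    by (rule integrableI_bounded_set_indicator[OF F meas fin, of B])
      (use mem B in \<open>auto simp: indicator_def\<close>)
  also have "(\<lambda>t. indicator ?F t *\<^sub>R ?h (face_point i c t)) = (\<lambda>t. indicator ?F t *\<^sub>R h (face_point i c t))"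
    using mem by (auto simp: indicator_def fun_eq_iff)
  finally show ?thesis unfolding set_integrable_def .
qed

text \<open>
  By Fubini the variable \<open>s\<^sup>i\<close> is integrated first, by the fundamental theorem of calculus.
\<close>

lemma integral_partial_deriv_cbox:
  fixes h :: "real ^ 'k::finite \<Rightarrow> 'b::euclidean_space"
  assumes ab: "a $ i \<le> b $ i"
    and h': "\<And>s. s \<in> cbox a b \<Longrightarrow> (h has_derivative h' s) (at s within cbox a b)"
    and cont: "continuous_on (cbox a b) (\<lambda>s. h' s (axis i 1))"
  shows "(LINT s : cbox a b | lborel. h' s (axis i 1))
    = face_integral a b i (b $ i) h - face_integral a b i (a $ i) h"
proof -
  let ?P = "\<Pi>\<^sub>M j\<in>UNIV - {i}. lborel :: real measure" and ?F = "\<Pi>\<^sub>E j\<in>UNIV - {i}. {a $ j..b $ j}"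
  let ?\<phi> = "\<lambda>s. indicator (cbox a b) s *\<^sub>R h' s (axis i 1)"
  have conth: "continuous_on (cbox a b) h"
    using h' by (rule has_derivative_continuous_on)
  have int: "integrable lborel ?\<phi>"
    by (rule borel_integrable_compact[OF compact_cbox cont])
  then have meas: "?\<phi> \<in> borel_measurable borel" by simp
  have U: "insert i (UNIV - {i}) = UNIV" by auto
  have fp: "(\<chi> j. (t(i := y)) j) = face_point i y t" for t :: "'k \<Rightarrow> real" and y
    by (simp add: face_point_def vec_eq_iff)
  have int': "integrable (\<Pi>\<^sub>M j\<in>insert i (UNIV - {i}). lborel) (\<lambda>t. ?\<phi> (\<chi> j. t j))"
    using int unfolding U
    by (subst (asm) lborel_vec_eq_distr) (simp add: integrable_distr_eq measurable_vec_lambda_PiM meas)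
  have "(LINT s : cbox a b | lborel. h' s (axis i 1)) = integral\<^sup>L (\<Pi>\<^sub>M j\<in>UNIV. lborel) (\<lambda>t. ?\<phi> (\<chi> j. t j))"
    unfolding set_lebesgue_integral_def
    by (subst lborel_vec_eq_distr) (rule integral_distr[OF measurable_vec_lambda_PiM meas])
  also have "\<dots> = (\<integral>t. (\<integral>y. ?\<phi> (face_point i y t) \<partial>lborel) \<partial>?P)"
    using lborel_prod.product_integral_insert[OF _ _ int'] unfolding U fp by simp
  also have "\<dots> = (\<integral>t. indicator ?F t *\<^sub>R h (face_point i (b $ i) t) - indicator ?F t *\<^sub>R h (face_point i (a $ i) t) \<partial>?P)"
  proof (rule Bochner_Integration.integral_cong[OF refl])
    fix t assume "t \<in> space ?P"
    then have ext: "t \<in> extensional (UNIV - {i})" by (simp add: space_PiM PiE_def)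
    show "(\<integral>y. ?\<phi> (face_point i y t) \<partial>lborel)
      = indicator ?F t *\<^sub>R h (face_point i (b $ i) t) - indicator ?F t *\<^sub>R h (face_point i (a $ i) t)"
    proof (cases "t \<in> ?F")
      case True
      have s: "face_point i (a $ i) t \<in> cbox a b"
        using True ab by (simp add: face_point_mem_cbox[OF ext])
      have "(\<integral>y. ?\<phi> (face_point i y t) \<partial>lborel)
        = (\<integral>y. indicator {a $ i..b $ i} y *\<^sub>R h' (face_point i y t) (axis i 1) \<partial>lborel)"
        using True by (intro Bochner_Integration.integral_cong) (auto simp: indicator_def face_point_mem_cbox[OF ext])
      also have "\<dots> = h (face_point i (b $ i) t) - h (face_point i (a $ i) t)"
      proof (rule integral_FTC_Icc[OF ab])
        fix y assume y: "a $ i \<le> y" "y \<le> b $ i"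
        then have mem: "set_coord (face_point i (a $ i) t) i y \<in> cbox a b"
          using True by (simp add: set_coord_face_point face_point_mem_cbox[OF ext])
        have "y \<in> {a $ i..b $ i}" using y by simp
        from has_vector_derivative_set_coord[OF s this h'[OF mem]]
        show "((\<lambda>y. h (face_point i y t)) has_vector_derivative h' (face_point i y t) (axis i 1)) (at y within {a $ i..b $ i})"
          by (simp only: set_coord_face_point)
      next
        have "continuous_on {a $ i..b $ i} (\<lambda>y. set_coord (face_point i (a $ i) t) i y)"
          unfolding set_coord_eq_line by (intro continuous_intros)
        then have "continuous_on {a $ i..b $ i} (\<lambda>y. face_point i y t)"
          by (simp add: set_coord_face_point)
        moreover have "(\<lambda>y. face_point i y t) ` {a $ i..b $ i} \<subseteq> cbox a b"
          using True by (intro image_subsetI) (simp add: face_point_mem_cbox[OF ext])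
        ultimately show "continuous_on {a $ i..b $ i} (\<lambda>y. h' (face_point i y t) (axis i 1))"
          by (rule continuous_on_compose2[OF cont])
      qed
      finally show ?thesis using True by simp
    next
      case False
      then show ?thesis by (simp add: face_point_mem_cbox[OF ext])
    qed
  qed
  also have "\<dots> = face_integral a b i (b $ i) h - face_integral a b i (a $ i) h"
    using integrable_face[OF conth, of "b $ i" i] integrable_face[OF conth, of "a $ i" i] ab
    by (simp add: face_integral_def set_lebesgue_integral_def set_integrable_def face_point_def)
  finally show ?thesis .
qed

lemma face_integral_cong:
  assumes "\<And>s. s \<in> cbox a b \<Longrightarrow> h s = h' s" "c \<in> {a $ i..b $ i}"
  shows "face_integral a b i c h = face_integral a b i c h'"
  unfolding face_integral_def
proof (rule set_lebesgue_integral_cong)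
  show "(\<Pi>\<^sub>E j\<in>UNIV - {i}. {a $ j..b $ j}) \<in> sets (\<Pi>\<^sub>M j\<in>UNIV - {i}. lborel)"
    by (rule sets_PiM_I_finite) auto
  show "\<forall>t. t \<in> (\<Pi>\<^sub>E j\<in>UNIV - {i}. {a $ j..b $ j}) \<longrightarrow>
      h (\<chi> j. if j = i then c else t j) = h' (\<chi> j. if j = i then c else t j)"
    using assms face_point_mem_cbox[of _ i c a b] by (auto simp: face_point_def PiE_def)
qed

lemma face_integral_minus: "face_integral a b i c (\<lambda>s. - h s) = - face_integral a b i c h"
  by (simp add: face_integral_def set_lebesgue_integral_def)

section \<open>Pulling back functions of class \<open>C\<^sup>1\<close> to a box\<close>

definition C1_deriv_on ::
    "('a::real_normed_vector) set \<Rightarrow> ('a \<Rightarrow> 'b::real_normed_vector) \<Rightarrow> ('a \<Rightarrow> 'a \<Rightarrow> 'b) \<Rightarrow> bool"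
  where "C1_deriv_on S h h' \<longleftrightarrow>
    (\<forall>s\<in>S. (h has_derivative h' s) (at s within S)) \<and> (\<forall>d. continuous_on S (\<lambda>s. h' s d))"

text \<open>
  On a box with nonempty interior the derivative is unique, so that local choices of a continuous
  derivative agree and the property becomes global.
\<close>

lemma C1_deriv_on_cbox_local:
  fixes a b :: "'a::euclidean_space"
  assumes ab: "\<And>i. i \<in> Basis \<Longrightarrow> a \<bullet> i < b \<bullet> i"
    and loc: "\<And>s\<^sub>0. s\<^sub>0 \<in> cbox a b \<Longrightarrow> \<exists>T D. open T \<and> s\<^sub>0 \<in> T \<and>
      (\<forall>s\<in>cbox a b \<inter> T. (h has_derivative D s) (at s within cbox a b)) \<and>
      (\<forall>d. continuous_on (cbox a b \<inter> T) (\<lambda>s. D s d))"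
  shows "\<exists>h'. C1_deriv_on (cbox a b) h h'"
proof -
  define h' where "h' s = (SOME D. (h has_derivative D) (at s within cbox a b))" for s
  have h': "(h has_derivative h' s) (at s within cbox a b)" if "s \<in> cbox a b" for s
  proof -
    have "\<exists>D. (h has_derivative D) (at s within cbox a b)" using loc[OF that] that by blast
    then show ?thesis unfolding h'_def by (rule someI_ex)
  qed
  have "continuous (at s\<^sub>0 within cbox a b) (\<lambda>s. h' s d)" if s: "s\<^sub>0 \<in> cbox a b" for s\<^sub>0 d
  proof -
    obtain T D where T: "open T" "s\<^sub>0 \<in> T"
      and D: "\<forall>s\<in>cbox a b \<inter> T. (h has_derivative D s) (at s within cbox a b)"
      and cont: "\<forall>d. continuous_on (cbox a b \<inter> T) (\<lambda>s. D s d)"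
      using loc[OF s] by blast
    have "h' s = D s" if "s \<in> cbox a b \<inter> T" for s
    proof (rule frechet_derivative_unique_within_closed_interval[OF ab])
      show "s \<in> cbox a b" using that by blast
      then show "(h has_derivative h' s) (at s within cbox a b)" by (rule h')
      show "(h has_derivative D s) (at s within cbox a b)" using D that by blast
    qed
    then have "continuous_on (cbox a b \<inter> T) (\<lambda>s. h' s d)"
      using cont[rule_format, of d] by (simp cong: continuous_on_cong_simp)
    then have "continuous (at s\<^sub>0 within cbox a b \<inter> T) (\<lambda>s. h' s d)"
      using s T(2) by (simp add: continuous_on_eq_continuous_within)
    moreover have "at s\<^sub>0 within cbox a b \<inter> T = at s\<^sub>0 within cbox a b"
      by (rule at_within_nhd[OF T(2,1)]) auto
    ultimately show ?thesis by simp
  qed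
  with h' have "C1_deriv_on (cbox a b) h h'"
    by (simp add: C1_deriv_on_def continuous_on_eq_continuous_within)
  then show ?thesis by (rule exI[where x = h'])
qed

text \<open>
  Continuity of a derivative in each fixed direction implies continuity along varying directions, as
  the derivative is linear in finitely many coordinates of the direction.
\<close>

lemma continuous_on_compose_derivative:
  fixes D :: "'b::euclidean_space \<Rightarrow> 'b \<Rightarrow> 'c::real_normed_vector"
  assumes lin: "\<And>s. s \<in> V \<Longrightarrow> linear (D (x s))"
    and D: "\<And>u. continuous_on V (\<lambda>s. D (x s) u)" and w: "continuous_on V w"
  shows "continuous_on V (\<lambda>s. D (x s) (w s))"
proof -
  have "D (x s) (w s) = (\<Sum>b\<in>Basis. (w s \<bullet> b) *\<^sub>R D (x s) b)" if "s \<in> V" for s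
  proof -
    have "D (x s) (w s) = D (x s) (\<Sum>b\<in>Basis. (w s \<bullet> b) *\<^sub>R b)" by (simp add: euclidean_representation)
    then show ?thesis
      by (simp only: linear_sum[OF lin[OF that]] linear_scale[OF lin[OF that]])
  qed
  then show ?thesis
    by (subst continuous_on_cong[OF refl]) (auto intro!: continuous_intros D w)
qed

text \<open>
  Different local extensions of \<open>f\<close> may have different derivatives transversally to the surface; only
  their compositions with the parametrization have to agree.
\<close>

lemma C1_deriv_on_pullback:
  fixes a b :: "'a::euclidean_space" and x :: "'a \<Rightarrow> 'b::euclidean_space"
  assumes ab: "\<And>i. i \<in> Basis \<Longrightarrow> a \<bullet> i < b \<bullet> i"
    and x: "C1_deriv_on (cbox a b) x x'" and M: "x ` cbox a b \<subseteq> M" and f: "Ck_near 1 N M f"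
  shows "\<exists>h'. C1_deriv_on (cbox a b) (\<lambda>s. f (x s)) h'"
proof (rule C1_deriv_on_cbox_local[OF ab])
  fix s\<^sub>0 assume s0: "s\<^sub>0 \<in> cbox a b"
  obtain W where "M \<subseteq> W" and f: "Ck_on_subset 1 f W"
    using f unfolding Ck_near_def by blast
  with M have W: "x s \<in> W" if "s \<in> cbox a b" for s
    using that by blast
  obtain U F where U: "open U" "x s\<^sub>0 \<in> U" and "Ck_on 1 F U" and fF: "\<forall>y\<in>U \<inter> W. F y = f y"
    using bspec[OF f[unfolded Ck_on_subset_def] W[OF s0]] by (elim exE conjE)
  from \<open>Ck_on 1 F U\<close>[unfolded One_nat_def Ck_on.simps]
  obtain F' where F': "\<forall>y\<in>U. (F has_derivative F' y) (at y within U)"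
    and contF': "\<forall>v. continuous_on U (\<lambda>y. F' y v)"
    by (elim exE conjE)
  have x': "(x has_derivative x' s) (at s within cbox a b)" if "s \<in> cbox a b" for s
    using x that by (simp add: C1_deriv_on_def)
  have contx': "continuous_on (cbox a b) (\<lambda>s. x' s d)" for d
    using x by (simp add: C1_deriv_on_def)
  have contx: "continuous_on (cbox a b) x"
    using x' by (rule has_derivative_continuous_on)
  obtain T where T: "open T" "T \<inter> cbox a b = x -` U \<inter> cbox a b"
    using contx U(1) unfolding continuous_on_open_invariant by blast
  have inU: "x s \<in> U" if "s \<in> cbox a b \<inter> T" for s
    using that T(2) by blast
  have "((\<lambda>s. f (x s)) has_derivative (\<lambda>d. F' (x s) (x' s d))) (at s within cbox a b)"
    if s: "s \<in> cbox a b \<inter> T" for s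
  proof -
    have "at s within cbox a b \<inter> T = at s within cbox a b"
      by (rule at_within_nhd[OF _ T(1)]) (use s in auto)
    moreover have "((\<lambda>s. F (x s)) has_derivative (\<lambda>d. F' (x s) (x' s d))) (at s within cbox a b \<inter> T)"
    proof (rule has_derivative_in_compose2[where t = U and g = F and g' = F'])
      show "x ` (cbox a b \<inter> T) \<subseteq> U" using inU by blast
      show "(x has_derivative x' s) (at s within cbox a b \<inter> T)"
        using s by (intro has_derivative_subset[OF x']) auto
    qed (use F' s in auto)
    then have "((\<lambda>s. f (x s)) has_derivative (\<lambda>d. F' (x s) (x' s d))) (at s within cbox a b \<inter> T)"
      by (rule has_derivative_transform[OF s, rotated]) (use fF W inU in auto)
    ultimately show ?thesis by simp
  qed
  moreover have "continuous_on (cbox a b \<inter> T) (\<lambda>s. F' (x s) (x' s d))" for d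
  proof (rule continuous_on_compose_derivative)
    show "linear (F' (x s))" if "s \<in> cbox a b \<inter> T" for s
      using has_derivative_linear[OF bspec[OF F' inU[OF that]]] .
    show "continuous_on (cbox a b \<inter> T) (\<lambda>s. F' (x s) u)" for u
      by (rule continuous_on_compose2[OF contF'[rule_format] continuous_on_subset[OF contx]]) (use inU in auto)
    show "continuous_on (cbox a b \<inter> T) (\<lambda>s. x' s d)"
      by (rule continuous_on_subset[OF contx']) auto
  qed
  moreover have "s\<^sub>0 \<in> T" using T(2) s0 U(2) by blast
  ultimately show "\<exists>T D. open T \<and> s\<^sub>0 \<in> T \<and>
      (\<forall>s\<in>cbox a b \<inter> T. ((\<lambda>s. f (x s)) has_derivative D s) (at s within cbox a b)) \<and>
      (\<forall>d. continuous_on (cbox a b \<inter> T) (\<lambda>s. D s d))"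
    using T(1) by (intro exI[of _ T] exI[of _ "\<lambda>s d. F' (x s) (x' s d)"]) simp
qed

section \<open>The fundamental theorem on a rectangular patch\<close>

theorem mainTheorem1:
  fixes a b :: "real ^ 'k::{finite,linorder}"
    and x :: "real ^ 'k::{finite,linorder} \<Rightarrow> real ^ 'n::{finite,linorder}"
    and N M :: "(real ^ 'n::{finite,linorder}) set"
    and f g :: "real ^ 'n::{finite,linorder} \<Rightarrow> 'n multivector"
    and p :: nat
  assumes "1 \<le> CARD('k)" "CARD('k) \<le> CARD('m::finite)" "CARD('m) \<le> CARD('n)"
    and "p \<ge> 2"
    and "surface TYPE('m) p N"
    and "rect_patch 2 a b x M"
    and "M \<subseteq> N"
    and "Ck_near 1 N M f" "Ck_near 1 N M g"
  shows "patch_integral a b x g f = boundary_integral a b x g f"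
proof -
  let ?R = "cbox a b"
  have ab: "a $ i < b $ i" for i
    using assms(6) by (simp add: rect_patch_def)
  then have abB: "a \<bullet> e < b \<bullet> e" if "e \<in> Basis" for e
    using that by (auto simp: Basis_vec_def inner_axis)
  have M: "x ` ?R = M"
    using assms(6) by (auto simp: rect_patch_def proper_regular_def homeomorphism_def)
  have indep: "inj (\<lambda>i. partial_deriv ?R x i s)" "independent (range (\<lambda>i. partial_deriv ?R x i s))"
    if "s \<in> ?R" for s
    using assms(6) that by (auto simp: rect_patch_def proper_regular_def)
  have "Ck_on 2 x ?R"
    using assms(6) by (simp add: rect_patch_def proper_regular_def)
  from this[unfolded numeral_2_eq_2 Ck_on.simps]
  obtain x' where x'_all: "\<forall>s\<in>?R. (x has_derivative x' s) (at s within ?R)"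
    and x'2: "\<forall>v. \<exists>D. (\<forall>s\<in>?R. ((\<lambda>s. x' s v) has_derivative D s) (at s within ?R)) \<and>
       (\<forall>w. continuous_on ?R (\<lambda>s. D s w))"
    by (elim exE conjE)
  from choice[OF x'2] obtain x''
    where x''_all: "\<forall>v. (\<forall>s\<in>?R. ((\<lambda>s. x' s v) has_derivative x'' v s) (at s within ?R)) \<and>
       (\<forall>w. continuous_on ?R (\<lambda>s. x'' v s w))"
    by (elim exE)
  have x': "(x has_derivative x' s) (at s within ?R)" if "s \<in> ?R" for s
    using x'_all that by (rule bspec)
  have x'': "((\<lambda>s. x' s v) has_derivative x'' v s) (at s within ?R)" if "s \<in> ?R" for v s
    using x''_all that by blast
  have contx'': "continuous_on ?R (\<lambda>s. x'' v s w)" for v w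
    using x''_all by blast
  have contx': "continuous_on ?R (\<lambda>s. x' s v)" for v
    using x'' by (rule has_derivative_continuous_on)
  have C1x: "C1_deriv_on ?R x x'"
    using x' contx' by (simp add: C1_deriv_on_def)
  have "\<exists>f'. C1_deriv_on ?R (\<lambda>s. f (x s)) f'"
    using C1_deriv_on_pullback[OF abB C1x equalityD1[OF M] assms(8)] by simp
  then obtain f' where f': "C1_deriv_on ?R (\<lambda>s. f (x s)) f'"
    by (elim exE)
  have "\<exists>g'. C1_deriv_on ?R (\<lambda>s. g (x s)) g'"
    using C1_deriv_on_pullback[OF abB C1x equalityD1[OF M] assms(9)] by simp
  then obtain g' where g': "C1_deriv_on ?R (\<lambda>s. g (x s)) g'"
    by (elim exE)

  define v where "v s j = x' s (axis j 1)" for s j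
  \<comment> \<open>The last tangent vector comes first, as in \<^const>\<open>wedge\<close>.\<close>
  define L where "L = rev (sorted_list_of_set (UNIV :: 'k set))"
  have L: "distinct L" "set L = UNIV" by (simp_all add: L_def)
  \<comment> \<open>The field \<open>T w\<^sub>i\<close> and its derivative, given by formulas in which \<open>w\<^sub>i\<close> does not occur.\<close>
  define C where "C i s = cofactor (v s) L i" for i s
  define C' where "C' i s d = cofactor_deriv (v s) (\<lambda>j. x'' (axis j 1) s d) L i" for i s d

  have C': "(C i has_derivative C' i s) (at s within ?R)" if "s \<in> ?R" for i s
    unfolding C_def C'_def by (rule cofactor_has_derivative[OF L(1)]) (simp add: v_def x''[OF that])
  have contv: "continuous_on ?R (\<lambda>s. v s j)" for j
    by (simp add: v_def contx')
  have contC': "continuous_on ?R (\<lambda>s. C' i s d)" for i d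
    unfolding C'_def by (intro continuous_on_cofactor_deriv contv contx'')
  have contC: "continuous_on ?R (C i)" for i
    using C' by (rule has_derivative_continuous_on)
  have div0: "(\<Sum>i\<in>UNIV. C' i s (axis i 1)) = 0" if "s \<in> ?R" for s
    using sum_cofactor_deriv_eq_0[OF L(1), where v = "v s" and H = "\<lambda>i j. x'' (axis j 1) s (axis i 1)"]
      second_derivative_symmetric_cbox[OF ab x' x'' contx'' that]
    unfolding C'_def L(2) by blast

  have pv: "partial_deriv ?R x i s = v s i" if "s \<in> ?R" for i s
    unfolding v_def by (rule partial_deriv_eq[OF ab that x'[OF that]])
  have TC: "tangent_kvector ?R x s * mvec (reciprocal_tangent ?R x i s) = C i s" if s: "s \<in> ?R" for i s
  proof -
    have eq: "(\<lambda>j. partial_deriv ?R x j s) = v s"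
      using pv[OF s] by (rule ext)
    have "\<exists>!w. w \<in> span (range (v s)) \<and> (\<forall>j. w \<bullet> v s j = (if i = j then 1 else 0))"
      by (rule reciprocal_ex1[OF indep[OF s, unfolded eq]])
    from theI'[OF this]
    have w: "reciprocal (v s) i \<in> span (range (v s))"
      "\<And>j. reciprocal (v s) i \<bullet> v s j = (if i = j then 1 else 0)"
      by (simp_all add: reciprocal_def)
    have "wedge (v s) L * mvec (reciprocal (v s) i) = cofactor (v s) L i"
      by (rule wedge_mult_reciprocal) (use w in \<open>auto simp: L inner_commute\<close>)
    moreover have "tangent_kvector ?R x s = wedge (v s) L"
      by (simp add: tangent_kvector_def foldl_outer_eq_wedge L_def pv[OF s])
    ultimately show ?thesis
      by (simp add: reciprocal_tangent_def eq C_def)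
  qed

  define G where "G i s = g (x s) * C i s * f (x s)" for i s
  define G' where "G' i s d = g (x s) * C i s * f' s d + (g (x s) * C' i s d + g' s d * C i s) * f (x s)" for i s d
  have fd: "((\<lambda>s. f (x s)) has_derivative f' s) (at s within ?R)" if "s \<in> ?R" for s
    using f' that by (simp add: C1_deriv_on_def)
  have gd: "((\<lambda>s. g (x s)) has_derivative g' s) (at s within ?R)" if "s \<in> ?R" for s
    using g' that by (simp add: C1_deriv_on_def)
  have G': "(G i has_derivative G' i s) (at s within ?R)" if "s \<in> ?R" for i s
    unfolding G_def G'_def
    by (rule times_multivector.FDERIV[OF times_multivector.FDERIV[OF gd[OF that] C'[OF that]] fd[OF that]])
  have contG': "continuous_on ?R (\<lambda>s. G' i s d)" for i d
  proof -
    have "continuous_on ?R (\<lambda>s. f (x s))" "continuous_on ?R (\<lambda>s. g (x s))"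
      using fd gd by (auto intro: has_derivative_continuous_on)
    moreover have "continuous_on ?R (\<lambda>s. f' s d)" "continuous_on ?R (\<lambda>s. g' s d)"
      using f' g' by (simp_all add: C1_deriv_on_def)
    ultimately show ?thesis
      unfolding G'_def by (intro continuous_on_add times_multivector.continuous_on contC contC')
  qed

  have integrand: "(\<Sum>i\<in>UNIV.
      partial_deriv ?R (g \<circ> x) i s * tangent_kvector ?R x s * mvec (reciprocal_tangent ?R x i s) * f (x s)
    + g (x s) * tangent_kvector ?R x s * mvec (reciprocal_tangent ?R x i s) * partial_deriv ?R (f \<circ> x) i s)
    = (\<Sum>i\<in>UNIV. G' i s (axis i 1))" if s: "s \<in> ?R" for s
  proof -
    have pf: "partial_deriv ?R (f \<circ> x) i s = f' s (axis i 1)" for i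
      unfolding o_def by (rule partial_deriv_eq[OF ab s fd[OF s]])
    have pg: "partial_deriv ?R (g \<circ> x) i s = g' s (axis i 1)" for i
      unfolding o_def by (rule partial_deriv_eq[OF ab s gd[OF s]])
    have "(\<Sum>i\<in>UNIV. G' i s (axis i 1))
      = (\<Sum>i\<in>UNIV. g' s (axis i 1) * C i s * f (x s) + g (x s) * C i s * f' s (axis i 1))
        + g (x s) * (\<Sum>i\<in>UNIV. C' i s (axis i 1)) * f (x s)"
      by (simp add: G'_def sum.distrib distrib_right sum_distrib_left sum_distrib_right)
    then show ?thesis
      by (simp add: div0[OF s] pf pg mult.assoc[of _ "tangent_kvector ?R x s"] TC[OF s])
  qed

  have face: "face_integral a b i c (\<lambda>s. g (x s) * boundary_tangent ?R x i \<sigma> s * f (x s))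
      = face_integral a b i c (\<lambda>s. \<sigma> *\<^sub>R G i s)" if "c \<in> {a $ i..b $ i}" for i c \<sigma>
    by (rule face_integral_cong[OF _ that]) (simp add: boundary_tangent_def TC G_def)

  have "patch_integral a b x g f = (LINT s : ?R | lborel. \<Sum>i\<in>UNIV. G' i s (axis i 1))"
    unfolding patch_integral_def
    by (rule set_lebesgue_integral_cong) (auto simp: integrand)
  also have "\<dots> = (\<Sum>i\<in>UNIV. LINT s : ?R | lborel. G' i s (axis i 1))"
    unfolding set_lebesgue_integral_def scaleR_sum_right
    by (rule Bochner_Integration.integral_sum) (rule borel_integrable_compact[OF compact_cbox contG'])
  also have "\<dots> = (\<Sum>i\<in>UNIV. face_integral a b i (b $ i) (G i) - face_integral a b i (a $ i) (G i))"
    by (rule sum.cong[OF refl integral_partial_deriv_cbox[OF less_imp_le[OF ab] G' contG']])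
  also have "\<dots> = boundary_integral a b x g f"
    using less_imp_le[OF ab] by (simp add: boundary_integral_def face face_integral_minus)
  finally show ?thesis .
qed

end
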